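(* Stanley's conjecture holds for graphic matroids of biconed graphs: for every biconed graph $G^{A,B}$, the $h$-vector $(h_0,\dots,h_d)$ of the graphic matroid $\mathcal{M}(G^{A,B})$ is a pure $\mathcal{O}$-sequence, i.e. there exists a pure multicomplex $\Delta$ on some finite set such that for every $i\ge 0$ the number of multisets in $\Delta$ of cardinality $i$ is $h_i$ (with $h_i:=0$ for $i>d$).
   Context: Graphs are finite and undirected, possibly with loops and parallel edges. Biconed graph: let $G$ be a graph and $A,B\subseteq V(G)$ (not necessarily disjoint) with $A\cup B=V(G)$. The biconing $G^{A,B}$ of $G$ is obtained by adding two new vertices $0$ and $\overline{0}$ and the edges $0\overline{0}$, $0a$ for all $a\in A$, and $\overline{0}b$ for all $b\in B$. A biconed graph is any graph so obtained. The graphic matroid $\mathcal{M}(H)$ of a graph $H$ has ground set $E(H)$ and independent sets the acyclic edge sets. For a matroid of rank $d$, let $f_{i-1}$ be the number of independent sets of size $i$; the $h$-vector $(h_0,\dots,h_d)$ is defined by $\sum_{i=0}^d f_{i-1}(t-1)^{d-i}=\sum_{k=0}^d h_k t^{d-k}$. A multicomplex on a finite set $E$ is a collection of finite multisets of elements of $E$ closed under taking sub-multisets (equivalently, a set of monomials closed under divisors). It is pure if all its facets (members maximal under inclusion) have the same cardinality, counted with multiplicity. An $\mathcal{O}$-sequence is the sequence counting the members of a multicomplex by cardinality; it is a pure $\mathcal{O}$-sequence if the multicomplex can be chosen pure. Trailing zeros of the $h$-vector are disregarded. *)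

theory Defs
  imports "HOL-Library.Multiset" "HOL-Library.Uprod" "HOL-Computational_Algebra.Polynomial"
begin

section \<open>Graphs with loops and parallel edges\<close>

text \<open>Edges are named objects, so parallel edges are distinct edges with the same
  ends; a loop at \<open>v\<close> has ends \<open>Upair v v\<close>.\<close>

record ('v, 'e) multigraph =
  verts :: "'v set"
  edges :: "'e set"
  ends :: "'e \<Rightarrow> 'v uprod"

definition finite_graph :: "('v, 'e) multigraph \<Rightarrow> bool" where
  "finite_graph G \<longleftrightarrow> finite (verts G) \<and> finite (edges G) \<and>
     (\<forall>e\<in>edges G. set_uprod (ends G e) \<subseteq> verts G)"

text \<open>Cycles of length 1 are loops. For length 2, distinctness of the edges
  makes the cycle a pair of parallel edges.\<close>

definition is_cycle :: "('v, 'e) multigraph \<Rightarrow> 'v list \<Rightarrow> 'e list \<Rightarrow> bool" where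
  "is_cycle G vs es \<longleftrightarrow>
     es \<noteq> [] \<and> length vs = length es \<and> distinct vs \<and> distinct es \<and>
     set vs \<subseteq> verts G \<and> set es \<subseteq> edges G \<and>
     (\<forall>i<length es. ends G (es ! i) = Upair (vs ! i) (vs ! (Suc i mod length es)))"

definition acyclic_edges :: "('v, 'e) multigraph \<Rightarrow> 'e set \<Rightarrow> bool" where
  "acyclic_edges G F \<longleftrightarrow> F \<subseteq> edges G \<and> \<not> (\<exists>vs es. is_cycle G vs es \<and> set es \<subseteq> F)"


section \<open>Biconed graphs\<close>

text \<open>The vertices \<open>Zero\<close> and \<open>ZeroBar\<close> are the new vertices $0$ and $\overline{0}$.\<close>

datatype 'v bicone_vertex = Orig 'v | Zero | ZeroBar

datatype ('v, 'e) bicone_edge = OrigEdge 'e | MidEdge | ZeroEdge 'v | ZeroBarEdge 'v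

primrec bicone_ends :: "('e \<Rightarrow> 'v uprod) \<Rightarrow> ('v, 'e) bicone_edge \<Rightarrow> 'v bicone_vertex uprod" where
  "bicone_ends g (OrigEdge e) = map_uprod Orig (g e)"
| "bicone_ends g MidEdge = Upair Zero ZeroBar"
| "bicone_ends g (ZeroEdge a) = Upair Zero (Orig a)"
| "bicone_ends g (ZeroBarEdge b) = Upair ZeroBar (Orig b)"

definition biconing ::
  "('v, 'e) multigraph \<Rightarrow> 'v set \<Rightarrow> 'v set \<Rightarrow> ('v bicone_vertex, ('v, 'e) bicone_edge) multigraph"
where
  "biconing G A B =
     \<lparr>verts = Orig ` verts G \<union> {Zero, ZeroBar},
      edges = OrigEdge ` edges G \<union> {MidEdge} \<union> ZeroEdge ` A \<union> ZeroBarEdge ` B,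
      ends = bicone_ends (ends G)\<rparr>"

lemma finite_graph_biconing:
  assumes "finite_graph G" and "A \<union> B = verts G"
  shows "finite_graph (biconing G A B)"
proof -
  have "finite A" "finite B"
    using assms by (auto simp: finite_graph_def intro: finite_subset[of _ "verts G"])
  moreover have "set_uprod (ends (biconing G A B) f) \<subseteq> verts (biconing G A B)"
    if "f \<in> edges (biconing G A B)" for f
    using that assms by (cases f) (fastforce simp: finite_graph_def biconing_def uprod.set_map)+
  ultimately show ?thesis
    using assms(1) by (simp add: finite_graph_def biconing_def)
qed


section \<open>Graphic matroids and h-vectors\<close>

text \<open>A matroid is given by its ground set and its family of independent sets.\<close>

type_synonym 'e matroid = "'e set \<times> 'e set set"

definition graphic_matroid :: "('v, 'e) multigraph \<Rightarrow> 'e matroid" where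
  "graphic_matroid G = (edges G, {F. acyclic_edges G F})"

definition indep :: "'e matroid \<Rightarrow> 'e set set" where
  "indep M = snd M"

definition matroid_rank :: "'e matroid \<Rightarrow> nat" where
  "matroid_rank M = Max (card ` indep M)"

text \<open>In the indexing of face vectors of simplicial complexes, \<open>num_indep M i\<close> is $f_{i-1}$.\<close>

definition num_indep :: "'e matroid \<Rightarrow> nat \<Rightarrow> nat" where
  "num_indep M i = card {I \<in> indep M. card I = i}"

definition h_poly :: "'e matroid \<Rightarrow> int poly" where
  "h_poly M = (\<Sum>i\<le>matroid_rank M.
     smult (int (num_indep M i)) ([:-1, 1:] ^ (matroid_rank M - i)))"

definition h_vector :: "'e matroid \<Rightarrow> nat \<Rightarrow> int" where
  "h_vector M k = (if k \<le> matroid_rank M then coeff (h_poly M) (matroid_rank M - k) else 0)"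

text \<open>The usual defining identity of the h-vector.\<close>

lemma h_vector_identity:
  fixes M :: "'e matroid" and t :: int
  defines "d \<equiv> matroid_rank M"
  shows "(\<Sum>i\<le>d. int (num_indep M i) * (t - 1) ^ (d - i)) = (\<Sum>k\<le>d. h_vector M k * t ^ (d - k))"
proof -
  have deg: "degree (h_poly M) \<le> d"
    unfolding h_poly_def d_def
  proof (rule degree_sum_le, simp)
    fix i
    assume "i \<in> {..matroid_rank M}"
    have "degree (smult (int (num_indep M i)) ([:-1, 1:] ^ (matroid_rank M - i)))
        \<le> degree ([:-1, 1 :: int:] ^ (matroid_rank M - i))"
      by (rule degree_smult_le)
    also have "\<dots> \<le> degree [:-1, 1 :: int:] * (matroid_rank M - i)"
      by (rule degree_power_le)
    also have "\<dots> \<le> matroid_rank M" by simp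
    finally show "degree (smult (int (num_indep M i)) ([:-1, 1:] ^ (matroid_rank M - i)))
        \<le> matroid_rank M" .
  qed
  have "(\<Sum>i\<le>d. int (num_indep M i) * (t - 1) ^ (d - i)) = poly (h_poly M) t"
    by (simp add: h_poly_def d_def poly_sum)
  also have "\<dots> = (\<Sum>j\<le>d. coeff (h_poly M) j * t ^ j)"
    by (subst poly_as_sum_of_monoms'[OF deg, symmetric]) (simp add: poly_sum poly_monom)
  also have "\<dots> = (\<Sum>k\<le>d. h_vector M k * t ^ (d - k))"
    by (rule sum.reindex_bij_witness[of _ "\<lambda>k. d - k" "\<lambda>k. d - k"])
      (auto simp: h_vector_def d_def)
  finally show ?thesis .
qed


section \<open>Pure O-sequences\<close>

definition multicomplex_on :: "'a set \<Rightarrow> 'a multiset set \<Rightarrow> bool" where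
  "multicomplex_on X \<Delta> \<longleftrightarrow> finite X \<and> (\<forall>m\<in>\<Delta>. set_mset m \<subseteq> X) \<and>
     (\<forall>m\<in>\<Delta>. \<forall>m'. m' \<subseteq># m \<longrightarrow> m' \<in> \<Delta>)"

definition facets :: "'a multiset set \<Rightarrow> 'a multiset set" where
  "facets \<Delta> = {m \<in> \<Delta>. \<forall>m'\<in>\<Delta>. m \<subseteq># m' \<longrightarrow> m' = m}"

definition pure_multicomplex :: "'a multiset set \<Rightarrow> bool" where
  "pure_multicomplex \<Delta> \<longleftrightarrow> (\<forall>m\<in>facets \<Delta>. \<forall>m'\<in>facets \<Delta>. size m = size m')"

text \<open>Every finite set can be relabelled by natural numbers, so multicomplexes on finite sets of
  naturals suffice. A sequence is a function on all naturals, so trailing zeros play no role. For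
  a sequence that is eventually zero, \<open>\<Delta>\<close> is necessarily finite, and hence each
  of its members lies in a facet.\<close>

definition pure_O_sequence :: "(nat \<Rightarrow> int) \<Rightarrow> bool" where
  "pure_O_sequence h \<longleftrightarrow> (\<exists>(X :: nat set) \<Delta>. multicomplex_on X \<Delta> \<and> pure_multicomplex \<Delta> \<and>
     (\<forall>i. int (card {m \<in> \<Delta>. size m = i}) = h i))"

end

theory Submission
  imports Defs
begin

text \<open>
  First let \<open>A\<close> and \<open>B\<close> be disjoint, and sort the independent sets of the biconing by their
  intersection \<open>F\<close> with \<open>E(G)\<close>, a forest. A component \<open>C\<close> of \<open>F\<close> with \<open>a\<close> vertices in \<open>A\<close> and \<open>b\<close> in \<open>B\<close>
  carries no cone edge or one of \<open>a + b\<close> cone edges, except that one component may carry two (one of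
  \<open>a b\<close> pairs) when the edge between the apices is absent. In terms of \<open>t = u + 1\<close> the f-polynomial
  becomes a sum over forests in which \<open>C\<close> carries no mark or one of \<open>a + b - 1\<close> marks, and one
  component may carry one of \<open>a b\<close> pairs of marks. Since \<open>C\<close> is a tree with \<open>a + b - 1\<close> edges, marks are
  edges of \<open>C\<close>. A pair of vertices \<open>(x, y)\<close> of different colours is replaced by the first
  and the last edge of the path from \<open>x\<close> to \<open>y\<close>, from which the pair can be recovered. So the h-vector
  counts monomials in the edges: the product of \<open>F\<close> and of the marks.

  Deleting an edge of \<open>F\<close> keeps a pair of marks admissible or separates the two marks, hence divisors
  of such monomials are of the same kind. In a maximal monomial \<open>F\<close> covers all non-isolated vertices
  and each nontrivial component is marked. If there is no pair of marks, every component is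
  monochromatic (otherwise a second mark could be added), and adding an edge between two
  components of different colours would turn their marks into an admissible pair. So a maximal
  monomial has a pair of marks iff the graph has an edge between different colours, and its degree is
  determined by the graph.

  A vertex in \<open>A \<inter> B\<close> is split into an \<open>A\<close>-vertex and a \<open>B\<close>-vertex, joined by an edge that
  belongs to every forest.
\<close>

section \<open>Connectivity and forests\<close>

definition adj :: "('e \<Rightarrow> 'v uprod) \<Rightarrow> 'e set \<Rightarrow> ('v \<times> 'v) set" where
  "adj g F = {(x, y). \<exists>e\<in>F. g e = Upair x y}"

definition conn :: "('e \<Rightarrow> 'v uprod) \<Rightarrow> 'e set \<Rightarrow> 'v \<Rightarrow> 'v \<Rightarrow> bool" where
  "conn g F x y \<longleftrightarrow> (x, y) \<in> (adj g F)\<^sup>*"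

text \<open>Acyclicity in the form that every edge is a bridge. Loops are excluded because their
  ends are trivially connected.\<close>

definition forest :: "('e \<Rightarrow> 'v uprod) \<Rightarrow> 'e set \<Rightarrow> bool" where
  "forest g F \<longleftrightarrow> (\<forall>e\<in>F. \<forall>x y. g e = Upair x y \<longrightarrow> \<not> conn g (F - {e}) x y)"

lemma Upair_commute: "Upair x y = Upair y x"
  by simp

lemma obtain_ends:
  obtains x y where "u = Upair x y"
  by (cases u)

lemma conn_refl [simp, intro]: "conn g F x x"
  by (simp add: conn_def)

lemma sym_adj: "sym (adj g F)"
  unfolding sym_def adj_def by (auto simp: Upair_inject) (metis Upair_commute)+

lemma conn_sym: "conn g F x y \<Longrightarrow> conn g F y x"
  unfolding conn_def using sym_rtrancl[OF sym_adj] by (meson symD)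

lemma conn_commute: "conn g F x y \<longleftrightarrow> conn g F y x"
  using conn_sym by metis

lemma conn_trans: "conn g F x y \<Longrightarrow> conn g F y z \<Longrightarrow> conn g F x z"
  unfolding conn_def by (rule rtrancl_trans)

lemma conn_edge: "e \<in> F \<Longrightarrow> g e = Upair x y \<Longrightarrow> conn g F x y"
  unfolding conn_def adj_def by (rule r_into_rtrancl) auto

lemma conn_mono: "F \<subseteq> F' \<Longrightarrow> conn g F x y \<Longrightarrow> conn g F' x y"
  unfolding conn_def using rtrancl_mono[of "adj g F" "adj g F'"] by (auto simp: adj_def)

lemma conn_induct [consumes 1, case_names refl step]:
  assumes "conn g F x y" and "P x"
    and "\<And>y z e. conn g F x y \<Longrightarrow> P y \<Longrightarrow> e \<in> F \<Longrightarrow> g e = Upair y z \<Longrightarrow> P z"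
  shows "P y"
  using assms(1) unfolding conn_def
proof (induction rule: rtrancl_induct)
  case base
  show ?case by (rule assms(2))
next
  case (step y z)
  then show ?case using assms(3) by (auto simp: adj_def conn_def)
qed

text \<open>Of a walk through \<open>e\<close> only the end at which it first reaches
  \<open>e\<close> and the end at which it last leaves \<open>e\<close> matter; if they agree, the
  walk can avoid \<open>e\<close>.\<close>

lemma conn_insert:
  assumes "g e = Upair x y"
  shows "conn g (insert e F) a b \<longleftrightarrow>
    conn g F a b \<or> conn g F a x \<and> conn g F y b \<or> conn g F a y \<and> conn g F x b" (is "_ \<longleftrightarrow> ?R b")
proof
  assume "conn g (insert e F) a b"
  then show "?R b"
  proof (induction rule: conn_induct)
    case refl
    show ?case by simp
  next
    case (step u v f)
    show ?case
    proof (cases "f = e")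
      case True
      then have "u = x \<and> v = y \<or> u = y \<and> v = x"
        using step.hyps(3) assms True by (metis Upair_inject)
      then show ?thesis using step.IH by (metis conn_refl conn_trans conn_sym)
    next
      case False
      then have "conn g F u v" using step.hyps(2,3) conn_edge by fast
      then show ?thesis using step.IH conn_trans by metis
    qed
  qed
next
  have m: "conn g F p q \<Longrightarrow> conn g (insert e F) p q" for p q
    by (rule conn_mono) auto
  have "conn g (insert e F) x y" using conn_edge[of e "insert e F" g x y] assms by simp
  moreover assume "?R b"
  ultimately show "conn g (insert e F) a b"
    using m conn_trans conn_sym by metis
qed

lemma conn_removed_edge:
  assumes "conn g F a b" and "\<not> conn g (F - {e}) a b" and "g e = Upair x y"
  shows "conn g (F - {e}) a x \<and> conn g (F - {e}) y b \<or> conn g (F - {e}) a y \<and> conn g (F - {e}) x b"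
proof -
  have "conn g (insert e (F - {e})) a b"
    by (rule conn_mono[OF _ assms(1)]) auto
  then show ?thesis using conn_insert[of g e x y "F - {e}" a b, OF assms(3)] assms(2) by blast
qed

lemma conn_closed:
  assumes "conn g F x y" and "x \<in> V" and "\<And>e. e \<in> F \<Longrightarrow> set_uprod (g e) \<subseteq> V"
  shows "y \<in> V"
  using assms(1)
proof (induction rule: conn_induct)
  case refl
  show ?case by (rule assms(2))
next
  case (step y z e)
  then show ?case using assms(3)[of e] by simp
qed

lemma conn_isolated:
  assumes "conn g F x y" and "\<And>e. e \<in> F \<Longrightarrow> x \<notin> set_uprod (g e)"
  shows "y = x"
  using assms(1)
proof (induction rule: conn_induct)
  case (step y z e)
  then show ?case using assms(2)[of e] by auto
qed simp

lemma forestD: "forest g F \<Longrightarrow> e \<in> F \<Longrightarrow> g e = Upair x y \<Longrightarrow> \<not> conn g (F - {e}) x y"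
  by (auto simp: forest_def)

lemma forest_subset: "forest g F \<Longrightarrow> F' \<subseteq> F \<Longrightarrow> forest g F'"
  unfolding forest_def by (meson Diff_mono conn_mono order_refl subsetD)

text \<open>If an old edge \<open>h\<close> stops being a bridge, its ends are joined by a walk
  through \<open>e\<close> that avoids \<open>h\<close>. The rest of this walk together with
  \<open>h\<close> joins \<open>x\<close> to \<open>y\<close> already in \<open>F\<close>.\<close>

lemma forest_insert:
  assumes "e \<notin> F" and e: "g e = Upair x y"
  shows "forest g (insert e F) \<longleftrightarrow> forest g F \<and> \<not> conn g F x y"
proof (intro iffI conjI)
  assume f: "forest g (insert e F)"
  show "forest g F" by (rule forest_subset[OF f]) auto
  show "\<not> conn g F x y" using forestD[OF f _ e] assms(1) by simp
next
  assume f: "forest g F \<and> \<not> conn g F x y"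
  show "forest g (insert e F)"
    unfolding forest_def
  proof (intro ballI allI impI notI)
    fix h a b
    assume h: "h \<in> insert e F" "g h = Upair a b" "conn g (insert e F - {h}) a b"
    show False
    proof (cases "h = e")
      case True
      then have "conn g F a b" using h(3) assms(1) by simp
      moreover have "(a = x \<and> b = y) \<or> (a = y \<and> b = x)" using True h(2) e by auto
      ultimately show False using f conn_sym by metis
    next
      case False
      then have hF: "h \<in> F" using h(1) by simp
      have "insert e F - {h} = insert e (F - {h})" using False by auto
      with h(3) have "conn g (insert e (F - {h})) a b" by simp
      moreover have "\<not> conn g (F - {h}) a b" using f forestD[of g F h a b] hF h(2) by blast
      ultimately have "conn g (F - {h}) a x \<and> conn g (F - {h}) y b
          \<or> conn g (F - {h}) a y \<and> conn g (F - {h}) x b"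
        using conn_insert[of g e x y, OF e] by blast
      then have "conn g F a x \<and> conn g F y b \<or> conn g F a y \<and> conn g F x b"
        using conn_mono[of "F - {h}" F g] by blast
      moreover have "conn g F a b" using conn_edge[of h F g a b] hF h(2) by blast
      ultimately show False using f conn_trans conn_sym by metis
    qed
  qed
qed

section \<open>Forests are the acyclic edge sets\<close>

lemma conn_simple_path:
  assumes "conn g F x y"
  shows "\<exists>vs es. length vs = Suc (length es) \<and> distinct vs \<and> vs ! 0 = x \<and> vs ! length es = y \<and>
    set es \<subseteq> F \<and> (\<forall>i<length es. g (es ! i) = Upair (vs ! i) (vs ! Suc i))"
  using assms
proof (induction rule: conn_induct)
  case refl
  show ?case by (rule exI[of _ "[x]"], rule exI[of _ "[]"]) simp
next
  case (step u z e)
  from step.IH obtain vs es where p: "length vs = Suc (length es)" "distinct vs" "vs ! 0 = x"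
    "vs ! length es = u" "set es \<subseteq> F" "\<forall>i<length es. g (es ! i) = Upair (vs ! i) (vs ! Suc i)"
    by (elim exE conjE) 
  show ?case
  proof (cases "z \<in> set vs")
    case True
    then obtain k where k: "k < length vs" "vs ! k = z" by (auto simp: in_set_conv_nth)
    \<comment> \<open>The next vertex was visited before, so the path is cut back to that
      visit.\<close>
    show ?thesis
      using p k by (intro exI[of _ "take (Suc k) vs"] exI[of _ "take k es"])
        (auto simp: min_def less_Suc_eq_le le_antisym dest: in_set_takeD)
  next
    case False
    show ?thesis
      using p False step.hyps
      by (intro exI[of _ "vs @ [z]"] exI[of _ "es @ [e]"]) (auto simp: nth_append less_Suc_eq)
  qed
qed

text \<open>The last edge of the cycle is not a bridge: the other edges lead from
  \<open>vs ! 0\<close> to its other end. For a loop this path is empty.\<close>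

lemma is_cycle_not_forest:
  assumes c: "is_cycle G vs es" and "set es \<subseteq> F"
  shows "\<not> forest (ends G) F"
proof
  assume f: "forest (ends G) F"
  from c have l: "es \<noteq> []" "length vs = length es" "distinct es"
    and s: "\<forall>i<length es. ends G (es ! i) = Upair (vs ! i) (vs ! (Suc i mod length es))"
    by (auto simp: is_cycle_def)
  define n where "n = length es - 1"
  have n: "length es = Suc n" using l(1) by (simp add: n_def)
  define e where "e = es ! n"
  have path: "i \<le> n \<Longrightarrow> conn (ends G) (F - {e}) (vs ! 0) (vs ! i)" for i
  proof (induction i)
    case 0
    show ?case by simp
  next
    case (Suc i)
    have "es ! i \<in> F" using Suc(2) n assms(2) by (metis Suc_leD le_imp_less_Suc nth_mem subsetD)
    moreover have "es ! i \<noteq> e"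
      using Suc(2) n l(3) by (simp add: e_def nth_eq_iff_index_eq)
    ultimately have "conn (ends G) (F - {e}) (vs ! i) (vs ! Suc i)"
      using s[rule_format, of i] Suc(2) n by (intro conn_edge[of "es ! i"]) auto
    then show ?case using Suc conn_trans by fastforce
  qed
  have "e \<in> F" using n assms(2) by (simp add: e_def subset_iff)
  moreover have "ends G e = Upair (vs ! n) (vs ! 0)"
    using s[rule_format, of n] n by (simp add: e_def)
  ultimately show False
    using forestD[OF f] path[of n] conn_sym by fastforce
qed

text \<open>If \<open>e\<close> is not a bridge, it closes a simple path that joins its ends and
  avoids \<open>e\<close> to a cycle.\<close>

lemma acyclic_edges_iff_forest:
  assumes "finite_graph G"
  shows "acyclic_edges G F \<longleftrightarrow> F \<subseteq> edges G \<and> forest (ends G) F"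
proof (cases "F \<subseteq> edges G")
  case True
  have "\<exists>vs es. is_cycle G vs es \<and> set es \<subseteq> F" if nf: "\<not> forest (ends G) F"
  proof -
    from nf obtain e x y where e: "e \<in> F" "ends G e = Upair x y" "conn (ends G) (F - {e}) x y"
      by (auto simp: forest_def)
    from conn_simple_path[OF e(3)] obtain vs es where p: "length vs = Suc (length es)" "distinct vs"
      "vs ! 0 = x" "vs ! length es = y" "set es \<subseteq> F - {e}"
      "\<forall>i<length es. ends G (es ! i) = Upair (vs ! i) (vs ! Suc i)"
      by blast
    have eq: "ends G ((es @ [e]) ! i) = Upair (vs ! i) (vs ! (Suc i mod Suc (length es)))"
      if "i < Suc (length es)" for i
    proof (cases "i = length es")
      case True
      then show ?thesis using p(3,4) e(2) by (simp add: Upair_commute)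
    next
      case False
      then have "i < length es" using that by simp
      then show ?thesis using p(6) by (simp add: nth_append)
    qed
    \<comment> \<open>Equal edges have equal pairs of ends, and along distinct vertices two pairs of
      consecutive vertices agree only at the same position.\<close>
    have "distinct es"
      unfolding distinct_conv_nth
    proof (intro allI impI notI)
      fix i j
      assume ij: "i < length es" "j < length es" "i \<noteq> j" "es ! i = es ! j"
      then have "Upair (vs ! i) (vs ! Suc i) = Upair (vs ! j) (vs ! Suc j)"
        using p(6) by metis
      then show False
        using ij p(1,2) by (auto simp: nth_eq_iff_index_eq)
    qed
    then have "distinct (es @ [e])" using p(5) by auto
    moreover have sub: "set (es @ [e]) \<subseteq> F" using p(5) e(1) by auto
    \<comment> \<open>Every vertex of the path, even of a trivial one, is an end of an edge of
      \<open>es @ [e]\<close>, hence a vertex of \<open>G\<close>.\<close>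
    moreover have "set vs \<subseteq> verts G"
    proof
      fix v
      assume "v \<in> set vs"
      then obtain i where i: "i < Suc (length es)" "v = vs ! i" using p(1) by (auto simp: in_set_conv_nth)
      have "(es @ [e]) ! i \<in> edges G" using i sub True by (metis length_append_singleton nth_mem subsetD)
      then show "v \<in> verts G" using eq[OF i(1)] i(2) assms by (fastforce simp: finite_graph_def)
    qed
    ultimately have "is_cycle G vs (es @ [e])"
      using p(1,2) eq True by (auto simp: is_cycle_def)
    then show ?thesis using sub by blast
  qed
  then show ?thesis using is_cycle_not_forest True unfolding acyclic_edges_def by blast
qed (simp add: acyclic_edges_def)

text \<open>The edges of \<open>S\<close> form a star with centre \<open>z\<close>. It merges the
  components of \<open>z\<close> and of the feet \<open>h s\<close> into one and creates no cycle
  iff these components are pairwise different. One induction gives both claims, since adding an edge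
  requires the connectivity of the smaller star.\<close>

lemma forest_star:
  assumes "finite S" and "\<And>s. s \<in> S \<Longrightarrow> g s = Upair z (h s)" and "S \<inter> J = {}"
  shows "(forest g (J \<union> S) \<longleftrightarrow> forest g J \<and> (\<forall>s\<in>S. \<not> conn g J z (h s)) \<and>
      (\<forall>s\<in>S. \<forall>s'\<in>S. s \<noteq> s' \<longrightarrow> \<not> conn g J (h s) (h s'))) \<and>
    (\<forall>x y. conn g (J \<union> S) x y \<longleftrightarrow> conn g J x y \<or>
      (conn g J z x \<or> (\<exists>s\<in>S. conn g J (h s) x)) \<and> (conn g J z y \<or> (\<exists>s\<in>S. conn g J (h s) y)))"
  using assms
proof (induction S rule: finite_induct)
  case empty
  then show ?case by (auto intro: conn_trans conn_sym)
next
  case (insert s S)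
  \<comment> \<open>\<open>T\<close> is the component of the centre after the edges of
    \<open>S\<close> have been added.\<close>
  define T where "T x \<longleftrightarrow> conn g J z x \<or> (\<exists>s\<in>S. conn g J (h s) x)" for x
  have IH: "forest g (J \<union> S) \<longleftrightarrow> forest g J \<and> (\<forall>s\<in>S. \<not> conn g J z (h s)) \<and>
      (\<forall>s\<in>S. \<forall>s'\<in>S. s \<noteq> s' \<longrightarrow> \<not> conn g J (h s) (h s'))"
    and IH': "conn g (J \<union> S) x y \<longleftrightarrow> conn g J x y \<or> T x \<and> T y" for x y
    using insert by (auto simp: T_def)
  have s: "g s = Upair z (h s)" "s \<notin> J \<union> S" using insert by auto
  have eq: "J \<union> insert s S = insert s (J \<union> S)" by auto
  have Tz: "T z" by (simp add: T_def)
  have TJ: "T x \<Longrightarrow> conn g J x y \<Longrightarrow> T y" for x y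
    unfolding T_def using conn_trans by metis
  have T': "conn g J z x \<or> (\<exists>s\<in>insert s S. conn g J (h s) x) \<longleftrightarrow> T x \<or> conn g J (h s) x" for x
    by (auto simp: T_def)
  have "forest g (J \<union> insert s S) \<longleftrightarrow> forest g (J \<union> S) \<and> \<not> T (h s)"
    unfolding eq forest_insert[of s "J \<union> S" g z "h s", OF s(2,1)] IH'
    using Tz TJ by (auto simp: T_def)
  moreover have "conn g (J \<union> insert s S) x y \<longleftrightarrow> conn g J x y \<or>
      (T x \<or> conn g J (h s) x) \<and> (T y \<or> conn g J (h s) y)" for x y
    unfolding eq conn_insert[of g s z "h s", OF s(1)] IH'
    using Tz TJ conn_sym conn_trans by (smt (verit))
  ultimately show ?case
    unfolding T' IH using s(2) by (auto simp: T_def conn_commute[of g J "h s"])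
qed

text \<open>In a forest, \<open>leaves g F e u v\<close> says that \<open>e\<close> is the first edge of the path from \<open>u\<close> to \<open>v\<close>.\<close>

definition leaves :: "('e \<Rightarrow> 'v uprod) \<Rightarrow> 'e set \<Rightarrow> 'e \<Rightarrow> 'v \<Rightarrow> 'v \<Rightarrow> bool" where
  "leaves g F e u v \<longleftrightarrow> e \<in> F \<and> u \<in> set_uprod (g e) \<and> conn g F u v \<and> \<not> conn g (F - {e}) u v"

lemma mem_ends: "u \<in> set_uprod w \<Longrightarrow> \<exists>q. w = Upair u q"
  by (cases w) auto

lemma leavesE:
  assumes "leaves g F e u v"
  obtains q where "e \<in> F" "g e = Upair u q" "conn g F u v" "\<not> conn g (F - {e}) u v"
    "conn g (F - {e}) q v"
proof -
  from assms obtain q where q: "g e = Upair u q" by (auto simp: leaves_def dest: mem_ends)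
  show ?thesis
    using that[OF _ q] assms conn_removed_edge[of g F u v e u q, OF _ _ q] q
    by (auto simp: leaves_def)
qed

text \<open>In the larger forest the other end \<open>q\<close> of \<open>e\<close> still reaches
  \<open>v\<close> without \<open>e\<close>; since \<open>e\<close> is still a bridge,
  \<open>u\<close> does not.\<close>

lemma leaves_mono:
  assumes "leaves g F e u v" and "F \<subseteq> F'" and f: "forest g F'"
  shows "leaves g F' e u v"
proof -
  from assms(1) obtain q where q: "e \<in> F" "g e = Upair u q" "conn g F u v" "conn g (F - {e}) q v"
    by (rule leavesE)
  have "conn g (F' - {e}) q v" by (rule conn_mono[OF _ q(4)]) (use assms(2) in auto)
  then have "\<not> conn g (F' - {e}) u v"
    using forestD[of g F' e u q, OF f] q(1,2) assms(2) conn_sym conn_trans by (metis subsetD)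
  then show ?thesis using q assms(2) conn_mono[OF assms(2)] by (auto simp: leaves_def)
qed

lemma leaves_antimono:
  assumes "leaves g F e u v" and "F' \<subseteq> F" and "e \<in> F'" and "conn g F' u v"
  shows "leaves g F' e u v"
  using assms conn_mono[of "F' - {e}" "F - {e}" g u v] by (auto simp: leaves_def)

text \<open>Some edge of \<open>F\<close> ends in \<open>u\<close>. Either it separates
  \<open>u\<close> from \<open>v\<close>, or it can be deleted without disconnecting them, and
  induction on the number of edges applies.\<close>

lemma ex_leaves:
  assumes "finite F" and "forest g F" and "conn g F u v" and "u \<noteq> v"
  shows "\<exists>e. leaves g F e u v"
  using assms
proof (induction "card F" arbitrary: F rule: less_induct)
  case less
  from less.prems(3,4) obtain w where "(u, w) \<in> adj g F"
    unfolding conn_def by (meson converse_rtranclE)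
  then obtain e where e: "e \<in> F" "g e = Upair u w" by (auto simp: adj_def)
  show ?case
  proof (cases "conn g (F - {e}) u v")
    case True
    have "forest g (F - {e})" by (rule forest_subset[OF less.prems(2)]) auto
    moreover have "card (F - {e}) < card F"
      using e(1) less.prems(1) by (rule card_Diff1_less[rotated])
    ultimately have "\<exists>h. leaves g (F - {e}) h u v"
      using less True by simp
    then show ?thesis using leaves_mono less.prems(2) by (metis Diff_subset)
  next
    case False
    then show ?thesis using e less.prems by (auto simp: leaves_def)
  qed
qed

text \<open>Suppose both edges come first, and take a walk from the far end \<open>q\<close> of
  \<open>e\<close> to \<open>v\<close> that avoids \<open>e\<close>. If it can avoid
  \<open>e'\<close> too, then \<open>u\<close> reaches \<open>v\<close> through \<open>e\<close>
  without \<open>e'\<close>. Otherwise it meets an end of \<open>e'\<close>, and \<open>u\<close>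
  reaches \<open>q\<close> without \<open>e\<close>, so \<open>e\<close> is no bridge.\<close>

lemma leaves_unique:
  assumes f: "forest g F" and l: "leaves g F e u v" "leaves g F e' u v"
  shows "e = e'"
proof (rule ccontr)
  assume ne: "e \<noteq> e'"
  from l(1) obtain q where q: "e \<in> F" "g e = Upair u q" "\<not> conn g (F - {e}) u v" "conn g (F - {e}) q v"
    by (rule leavesE)
  from l(2) obtain q' where q': "e' \<in> F" "g e' = Upair u q'" "\<not> conn g (F - {e'}) u v"
    by (rule leavesE)
  have nu: "\<not> conn g (F - {e}) u q" using forestD[of g F e u q] f q by blast
  have u': "conn g (F - {e}) u q'" using conn_edge[of e' "F - {e}" g u q'] q' ne by simp
  have m: "conn g (F - {e} - {e'}) x y \<Longrightarrow> conn g (F - {e}) x y \<and> conn g (F - {e'}) x y" for x y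
    using conn_mono[of "F - {e} - {e'}" "F - {e}" g x y] conn_mono[of "F - {e} - {e'}" "F - {e'}" g x y]
    by blast
  show False
  proof (cases "conn g (F - {e} - {e'}) q v")
    case True
    moreover have "conn g (F - {e'}) u q" using conn_edge[of e "F - {e'}" g u q] q ne by simp
    ultimately show False using m q'(3) conn_trans by metis
  next
    case False
    then have "conn g (F - {e} - {e'}) q u \<or> conn g (F - {e} - {e'}) q q'"
      using conn_removed_edge[of g "F - {e}" q v e' u q'] q(4) q'(2) by blast
    then show False using m nu u' conn_trans conn_sym by metis
  qed
qed

text \<open>The first and the last edge of a path determine its ends. For
  \<open>e \<noteq> k\<close>, if \<open>u'\<close> were the other end of \<open>e\<close>, then
  \<open>u\<close> would reach \<open>v'\<close> without \<open>e\<close>, and from there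
  \<open>v\<close> along \<open>k\<close>. For \<open>e = k\<close> the path is this single edge and
  its direction is lost, hence the second alternative.\<close>

lemma leaves_pair_ends:
  assumes f: "forest g F" and "leaves g F e u v" "leaves g F k v u"
    and "leaves g F e u' v'" "leaves g F k v' u'"
  shows "u = u' \<and> v = v' \<or> e = k \<and> u = v' \<and> v = u'"
proof -
  have *: "u = u'" if ek: "e \<noteq> k" and l: "leaves g F e u v" "leaves g F k v u"
    "leaves g F e u' v'" "leaves g F k v' u'" for e k u v u' v'
  proof (rule ccontr)
    assume "u \<noteq> u'"
    from l(1) obtain q where q: "g e = Upair u q" "e \<in> F" "conn g (F - {e}) q v" "\<not> conn g (F - {e}) u v"
      by (rule leavesE)
    from l(3) obtain q' where q': "g e = Upair u' q'" "conn g (F - {e}) q' v'" by (rule leavesE)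
    have eq: "q' = u" using q(1) q'(1) \<open>u \<noteq> u'\<close> by auto
    from l(2,4) have "v \<in> set_uprod (g k)" "v' \<in> set_uprod (g k)" "k \<in> F - {e}"
      using ek by (auto simp: leaves_def)
    then have "conn g (F - {e}) v v'"
      using conn_edge[of k "F - {e}" g v v'] by (cases "v = v'") (auto dest!: mem_ends)
    then show False using q(4) q'(2) eq conn_trans conn_sym by metis
  qed
  show ?thesis
  proof (cases "e = k")
    case True
    have "u \<noteq> v" "u' \<noteq> v'" using assms by (auto simp: leaves_def)
    moreover have "{u, v, u', v'} \<subseteq> set_uprod (g e)" using assms True by (auto simp: leaves_def)
    ultimately show ?thesis using True by (cases "g e") auto
  next
    case False
    then show ?thesis using *[of e k u v u' v'] *[of k e v u v' u'] assms by blast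
  qed
qed

section \<open>Components of a forest\<close>

definition component :: "('e \<Rightarrow> 'v uprod) \<Rightarrow> 'v set \<Rightarrow> 'e set \<Rightarrow> 'v \<Rightarrow> 'v set" where
  "component g V F x = {z \<in> V. conn g F x z}"

definition components :: "('e \<Rightarrow> 'v uprod) \<Rightarrow> 'v set \<Rightarrow> 'e set \<Rightarrow> 'v set set" where
  "components g V F = component g V F ` V"

text \<open>The quantifier over the ends avoids choosing one of them; for \<open>e \<in> F\<close>
  both give the same component.\<close>

definition edge_component :: "('e \<Rightarrow> 'v uprod) \<Rightarrow> 'v set \<Rightarrow> 'e set \<Rightarrow> 'e \<Rightarrow> 'v set" where
  "edge_component g V F e = {z \<in> V. \<exists>p\<in>set_uprod (g e). conn g F p z}"

lemma component_eq_iff: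
  assumes "y \<in> V"
  shows "component g V F x = component g V F y \<longleftrightarrow> conn g F x y"
proof
  assume eq: "component g V F x = component g V F y"
  have "y \<in> component g V F y" using assms by (simp add: component_def)
  then have "y \<in> component g V F x" using eq by simp
  then show "conn g F x y" by (simp add: component_def)
next
  assume "conn g F x y"
  then have "conn g F x z \<longleftrightarrow> conn g F y z" for z
    using conn_sym conn_trans by metis
  then show "component g V F x = component g V F y" by (simp add: component_def)
qed

lemma conn_ends: "e \<in> F \<Longrightarrow> p \<in> set_uprod (g e) \<Longrightarrow> q \<in> set_uprod (g e) \<Longrightarrow> conn g F p q"
  using conn_edge[of e F g] by (cases "g e") (auto intro: conn_sym)

lemma edge_component_eq:
  assumes "e \<in> F" and "p \<in> set_uprod (g e)"
  shows "edge_component g V F e = component g V F p"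
proof -
  have "(\<exists>q\<in>set_uprod (g e). conn g F q z) \<longleftrightarrow> conn g F p z" for z
    using assms conn_ends[of e F p g] conn_trans[of g F p _ z] by auto
  then show ?thesis by (simp add: edge_component_def component_def)
qed

lemma edge_component_eq_component_iff:
  assumes "e \<in> F" and "p \<in> set_uprod (g e)" and "x \<in> V"
  shows "edge_component g V F e = component g V F x \<longleftrightarrow> conn g F p x"
  using edge_component_eq[of e F p g V] component_eq_iff[of x V g F p] assms by simp

text \<open>A tree has one vertex more than it has edges. In the induction the new edge merges two
  trees, whose surpluses add up to two, and the edge itself reduces this to one.\<close>

lemma card_component:
  assumes "finite F" and "finite V" and "forest g F" and "\<And>e. e \<in> F \<Longrightarrow> set_uprod (g e) \<subseteq> V"
    and "x \<in> V"
  shows "card {z \<in> V. conn g F x z} = Suc (card {e \<in> F. \<exists>p\<in>set_uprod (g e). conn g F p x})"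
  using assms(1,3-)
proof (induction F arbitrary: x rule: finite_induct)
  case empty
  have "conn g {} x z \<longleftrightarrow> x = z" for z by (simp add: conn_def adj_def)
  then have "{z \<in> V. conn g {} x z} = {x}" using empty by auto
  then show ?case by simp
next
  case (insert e F)
  obtain p q where e: "g e = Upair p q" by (rule obtain_ends)
  have f: "forest g F" "\<not> conn g F p q"
    using forest_insert[of e F g p q] insert.hyps insert.prems(1) e by blast+
  have V: "p \<in> V" "q \<in> V" using insert.prems(2)[of e] e by auto
  define vs where "vs x = {z \<in> V. conn g F x z}" for x
  define es where "es x = {h \<in> F. \<exists>p\<in>set_uprod (g h). conn g F p x}" for x
  define vs' where "vs' x = {z \<in> V. conn g (insert e F) x z}" for x
  define es' where "es' x = {h \<in> insert e F. \<exists>p\<in>set_uprod (g h). conn g (insert e F) p x}" for x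
  have IH: "card (vs x) = Suc (card (es x))" if "x \<in> V" for x
    using insert.IH[OF f(1) _ that] insert.prems(2) by (simp add: vs_def es_def)
  have fin: "finite (vs x)" "finite (es x)" for x
    using assms(2) insert.hyps by (auto simp: vs_def es_def)
  have c: "conn g (insert e F) a b \<longleftrightarrow>
    conn g F a b \<or> conn g F a p \<and> conn g F q b \<or> conn g F a q \<and> conn g F p b" for a b
    using conn_insert[of g e p q] e by blast
  have merge: "card (vs' x) = Suc (card (es' x))" if "conn g F x p \<or> conn g F x q"
  proof -
    have vz: "conn g (insert e F) x z \<longleftrightarrow> conn g F p z \<or> conn g F q z" for z
    proof -
      have tr: "conn g F a b \<Longrightarrow> conn g F a z \<longleftrightarrow> conn g F b z" for a b
        using conn_sym conn_trans by metis
      show ?thesis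
        using that unfolding c by (auto dest: tr)
    qed
    have ez: "conn g (insert e F) z x \<longleftrightarrow> conn g F z p \<or> conn g F z q" for z
      using vz[of z] by (simp add: conn_commute[of g _ z])
    have "vs' x = vs p \<union> vs q" unfolding vs_def vs'_def vz by auto
    moreover have "vs p \<inter> vs q = {}"
    proof (rule ccontr)
      assume "vs p \<inter> vs q \<noteq> {}"
      then show False using f(2) conn_sym conn_trans unfolding vs_def by fast
    qed
    moreover have "es' x = insert e (es p \<union> es q)"
      unfolding es_def es'_def ez using e by auto
    moreover have "es p \<inter> es q = {}"
    proof (rule ccontr)
      assume "es p \<inter> es q \<noteq> {}"
      then obtain h a b where "h \<in> F" "a \<in> set_uprod (g h)" "b \<in> set_uprod (g h)"
        "conn g F a p" "conn g F b q"
        by (auto simp: es_def)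
      then show False using f(2) conn_ends[of h F a g b] conn_sym conn_trans by metis
    qed
    moreover have "e \<notin> es p \<union> es q" using insert.hyps(2) by (auto simp: es_def)
    ultimately show ?thesis using IH V fin by (simp add: card_Un_disjoint)
  qed
  have "card (vs' x) = Suc (card (es' x))"
  proof (cases "conn g F x p \<or> conn g F x q")
    case True
    then show ?thesis by (rule merge)
  next
    case False
    have "vs' x = vs x" using False unfolding vs_def vs'_def c by auto
    moreover have "es' x = es x"
      using False e unfolding es_def es'_def c by (auto dest: conn_sym)
    ultimately show ?thesis using IH insert.prems(3) by simp
  qed
  then show ?case by (simp add: vs'_def es'_def)
qed

lemma card_edges_in_component:
  assumes "finite F" and "finite V" and "forest g F" and "\<And>e. e \<in> F \<Longrightarrow> set_uprod (g e) \<subseteq> V"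
    and "C \<in> components g V F"
  shows "card C = Suc (card {e \<in> F. edge_component g V F e = C})"
proof -
  obtain x where x: "x \<in> V" "C = component g V F x" using assms(5) by (auto simp: components_def)
  have "edge_component g V F e = C \<longleftrightarrow> (\<exists>p\<in>set_uprod (g e). conn g F p x)" if "e \<in> F" for e
  proof -
    obtain p q where "g e = Upair p q" by (rule obtain_ends)
    then show ?thesis
      using edge_component_eq_component_iff[of e F _ g x V] that x by fastforce
  qed
  then have "{e \<in> F. edge_component g V F e = C} = {e \<in> F. \<exists>p\<in>set_uprod (g e). conn g F p x}"
    by auto
  then show ?thesis using card_component[OF assms(1-4) x(1)] x(2) by (simp add: component_def)
qed

lemma edge_component_in_components:
  assumes "e \<in> F" and "set_uprod (g e) \<subseteq> V"
  shows "edge_component g V F e \<in> components g V F"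
proof -
  obtain p q where "g e = Upair p q" by (rule obtain_ends)
  then show ?thesis
    using edge_component_eq[of e F p g V] assms by (auto simp: components_def)
qed

lemma card_eq_sum_card_fibres:
  assumes "finite X" and "finite Y" and "f ` X \<subseteq> Y"
  shows "card X = (\<Sum>y\<in>Y. card {x \<in> X. f x = y})"
  using sum.group[OF assms, of "\<lambda>_. 1 :: nat"] by simp

lemma component_fibre:
  assumes "C \<in> components g V F"
  shows "{x \<in> V. component g V F x = C} = C"
proof -
  obtain y where "y \<in> V" "C = component g V F y" using assms by (auto simp: components_def)
  then show ?thesis
    using component_eq_iff[of y V g F] by (auto simp: component_def conn_commute[of g F y])
qed

lemma card_forest:
  assumes "finite F" and "finite V" and "forest g F" and "\<And>e. e \<in> F \<Longrightarrow> set_uprod (g e) \<subseteq> V"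
  shows "card F + card (components g V F) = card V"
proof -
  let ?C = "components g V F"
  have fin: "finite ?C" using assms(2) by (simp add: components_def)
  have "card V = (\<Sum>C\<in>?C. card {x \<in> V. component g V F x = C})"
    by (rule card_eq_sum_card_fibres[OF assms(2) fin]) (auto simp: components_def)
  also have "\<dots> = (\<Sum>C\<in>?C. Suc (card {e \<in> F. edge_component g V F e = C}))"
    using component_fibre[of _ g V F] card_edges_in_component[OF assms]
    by (intro sum.cong refl) simp
  also have "\<dots> = (\<Sum>C\<in>?C. card {e \<in> F. edge_component g V F e = C}) + card ?C"
    by (rule sum_Suc)
  also have "(\<Sum>C\<in>?C. card {e \<in> F. edge_component g V F e = C}) = card F"
    using edge_component_in_components[of _ F g V] assms(4)
    by (intro card_eq_sum_card_fibres[OF assms(1) fin, symmetric]) auto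
  finally show ?thesis by simp
qed

section \<open>Marking the classes of a partition\<close>

text \<open>The partial transversals of the partition of \<open>X\<close> into the fibres of
  \<open>\<kappa>\<close>.\<close>

definition ptrans :: "('x \<Rightarrow> 'c) \<Rightarrow> 'x set \<Rightarrow> 'x set set" where
  "ptrans \<kappa> X = {K. K \<subseteq> X \<and> inj_on \<kappa> K}"

lemma finite_ptrans: "finite X \<Longrightarrow> finite (ptrans \<kappa> X)"
  by (rule finite_subset[of _ "Pow X"]) (auto simp: ptrans_def)

lemma card_ptrans_le:
  assumes "finite \<C>" and "\<kappa> ` X \<subseteq> \<C>" and "K \<in> ptrans \<kappa> X"
  shows "card K \<le> card \<C>"
proof -
  have "card K = card (\<kappa> ` K)" using assms(3) by (simp add: ptrans_def card_image)
  also have "\<dots> \<le> card \<C>" using assms by (intro card_mono) (auto simp: ptrans_def)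
  finally show ?thesis .
qed

text \<open>Expansion of the product: a class contributes \<open>u\<close> if the transversal misses
  it, and 1 for each element that can be chosen from it. The induction splits off one class
  \<open>D\<close>.\<close>

lemma sum_ptrans:
  fixes u :: "'a::comm_semiring_1" and \<kappa> :: "'x \<Rightarrow> 'c"
  assumes "finite \<C>" and "finite X" and "\<kappa> ` X \<subseteq> \<C>"
  shows "(\<Sum>K\<in>ptrans \<kappa> X. u ^ (card \<C> - card K)) = (\<Prod>C\<in>\<C>. u + of_nat (card {x \<in> X. \<kappa> x = C}))"
  using assms
proof (induction \<C> arbitrary: X rule: finite_induct)
  case empty
  then have "ptrans \<kappa> X = {{}}" by (auto simp: ptrans_def)
  then show ?case by simp
next
  case (insert D \<C>)
  define X0 X1 where "X0 = {x \<in> X. \<kappa> x \<noteq> D}" and "X1 = {x \<in> X. \<kappa> x = D}"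
  have X0: "finite X0" "\<kappa> ` X0 \<subseteq> \<C>" using insert.prems by (auto simp: X0_def)
  define add :: "'x set \<times> 'x \<Rightarrow> 'x set" where "add = (\<lambda>(K, x). insert x K)"
  have K0: "K \<in> ptrans \<kappa> X0 \<Longrightarrow> finite K \<and> card K \<le> card \<C> \<and> (\<forall>x\<in>X1. x \<notin> K)" for K
    using card_ptrans_le[OF insert.hyps(1) X0(2)] X0(1)
    by (auto simp: ptrans_def X0_def X1_def intro: finite_subset)
  have "ptrans \<kappa> X = ptrans \<kappa> X0 \<union> add ` (ptrans \<kappa> X0 \<times> X1)"
  proof (intro equalityI subsetI)
    fix K
    assume K: "K \<in> ptrans \<kappa> X"
    show "K \<in> ptrans \<kappa> X0 \<union> add ` (ptrans \<kappa> X0 \<times> X1)"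
    proof (cases "\<exists>x\<in>K. \<kappa> x = D")
      case True
      then obtain x where x: "x \<in> K" "\<kappa> x = D" by blast
      have "K - {x} \<in> ptrans \<kappa> X0"
        using K x unfolding ptrans_def X0_def inj_on_def by auto
      moreover have "x \<in> X1" using K x by (auto simp: ptrans_def X1_def)
      moreover have "K = add (K - {x}, x)" using x by (auto simp: add_def)
      ultimately show ?thesis by blast
    next
      case False
      then show ?thesis using K by (auto simp: ptrans_def X0_def)
    qed
  next
    fix K
    assume "K \<in> ptrans \<kappa> X0 \<union> add ` (ptrans \<kappa> X0 \<times> X1)"
    then show "K \<in> ptrans \<kappa> X"
      by (fastforce simp: ptrans_def X0_def X1_def add_def inj_on_def)
  qed
  moreover have "ptrans \<kappa> X0 \<inter> add ` (ptrans \<kappa> X0 \<times> X1) = {}"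
    using K0 by (auto simp: add_def)
  moreover have inj: "inj_on add (ptrans \<kappa> X0 \<times> X1)"
  proof (rule inj_onI, clarify)
    fix K x K' x'
    assume a: "K \<in> ptrans \<kappa> X0" "x \<in> X1" "K' \<in> ptrans \<kappa> X0" "x' \<in> X1" "add (K, x) = add (K', x')"
    then have "x \<notin> K" "x \<notin> K'" "x' \<notin> K" "x' \<notin> K'" using K0 by auto
    then show "K = K' \<and> x = x'" using a(5) by (auto simp: add_def)
  qed
  moreover have "finite (ptrans \<kappa> X0)" "finite X1"
    using finite_ptrans X0(1) insert.prems by (auto simp: X1_def)
  ultimately have "(\<Sum>K\<in>ptrans \<kappa> X. u ^ (card (insert D \<C>) - card K)) =
      (\<Sum>K\<in>ptrans \<kappa> X0. u ^ (card (insert D \<C>) - card K)) +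
      (\<Sum>K\<in>add ` (ptrans \<kappa> X0 \<times> X1). u ^ (card (insert D \<C>) - card K))"
    by (simp add: sum.union_disjoint)
  also have "(\<Sum>K\<in>ptrans \<kappa> X0. u ^ (card (insert D \<C>) - card K)) =
      u * (\<Sum>K\<in>ptrans \<kappa> X0. u ^ (card \<C> - card K))"
    using K0 insert.hyps by (simp add: sum_distrib_left Suc_diff_le flip: power_Suc)
  also have "(\<Sum>K\<in>add ` (ptrans \<kappa> X0 \<times> X1). u ^ (card (insert D \<C>) - card K)) =
      (\<Sum>(K, x)\<in>ptrans \<kappa> X0 \<times> X1. u ^ (card \<C> - card K))"
    unfolding sum.reindex[OF inj]
    using K0 insert.hyps by (intro sum.cong) (auto simp: add_def)
  also have "\<dots> = (\<Sum>K\<in>ptrans \<kappa> X0. u ^ (card \<C> - card K)) * of_nat (card X1)"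
    by (simp add: sum.cartesian_product[symmetric] sum_distrib_left mult.commute)
  also have "(\<Sum>K\<in>ptrans \<kappa> X0. u ^ (card \<C> - card K)) =
      (\<Prod>C\<in>\<C>. u + of_nat (card {x \<in> X0. \<kappa> x = C}))"
    by (rule insert.IH[OF X0])
  also have "\<dots> = (\<Prod>C\<in>\<C>. u + of_nat (card {x \<in> X. \<kappa> x = C}))"
    using insert.hyps(2) by (intro prod.cong refl) (auto simp: X0_def intro!: arg_cong[where f = "\<lambda>A. _ + of_nat (card A)"])
  finally show ?case
    using insert.hyps by (simp add: X1_def algebra_simps)
qed

text \<open>In a single marking each class carries at most one mark; in a double marking exactly one class
  carries a pair of marks, taken from a prescribed family.\<close>

definition single_marks :: "('x \<Rightarrow> 'c) \<Rightarrow> 'x set \<Rightarrow> 'x multiset set" where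
  "single_marks \<kappa> X = mset_set ` ptrans \<kappa> X"

definition double_marks ::
  "('x \<Rightarrow> 'c) \<Rightarrow> 'x set \<Rightarrow> ('z \<Rightarrow> 'c) \<Rightarrow> ('z \<Rightarrow> 'x multiset) \<Rightarrow> 'z set \<Rightarrow> 'x multiset set" where
  "double_marks \<kappa> X k pr Z =
    (\<lambda>(z, K). pr z + mset_set K) ` (SIGMA z:Z. ptrans \<kappa> {x \<in> X. \<kappa> x \<noteq> k z})"

lemma sum_single_marks:
  fixes u :: "'a::comm_semiring_1"
  assumes "finite \<C>" and "finite X" and "\<kappa> ` X \<subseteq> \<C>"
  shows "(\<Sum>W\<in>single_marks \<kappa> X. u ^ (card \<C> - size W)) =
    (\<Prod>C\<in>\<C>. u + of_nat (card {x \<in> X. \<kappa> x = C}))"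
proof -
  have fin: "K \<in> ptrans \<kappa> X \<Longrightarrow> finite K" for K
    using assms(2) by (auto simp: ptrans_def intro: finite_subset)
  then have "inj_on mset_set (ptrans \<kappa> X)"
    by (metis inj_onI finite_set_mset_mset_set)
  then show ?thesis
    unfolding single_marks_def using sum_ptrans[OF assms, of u] fin by (simp add: sum.reindex)
qed

text \<open>Common setting of the two counts to be compared: the marks are edges of a forest in one
  and vertices, that is cone edges, in the other. \<open>Z\<close> indexes the admissible pairs,
  \<open>pr\<close> gives their two marks and \<open>k\<close> their class.\<close>

locale marked_pairs =
  fixes \<C> :: "'c set" and X :: "'x set" and \<kappa> :: "'x \<Rightarrow> 'c"
    and Z :: "'z set" and k :: "'z \<Rightarrow> 'c" and pr :: "'z \<Rightarrow> 'x multiset"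
  assumes fin: "finite \<C>" "finite X" "finite Z"
    and cls: "\<kappa> ` X \<subseteq> \<C>" "k ` Z \<subseteq> \<C>"
    and inj: "inj_on pr Z"
    and pr: "\<And>z. z \<in> Z \<Longrightarrow> size (pr z) = 2"
      "\<And>z x. z \<in> Z \<Longrightarrow> x \<in># pr z \<Longrightarrow> x \<in> X \<and> \<kappa> x = k z"
begin

text \<open>Serves to read the pair off a double marking, once its class is known.\<close>

lemma filter_pair:
  assumes "z \<in> Z" and "K \<in> ptrans \<kappa> {x \<in> X. \<kappa> x \<noteq> k z}"
  shows "filter_mset (\<lambda>x. \<kappa> x = k z) (pr z + mset_set K) = pr z"
proof -
  have "finite K" using assms(2) fin by (auto simp: ptrans_def intro: finite_subset)
  moreover have "{x \<in> K. \<kappa> x = k z} = {}" using assms(2) by (auto simp: ptrans_def)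
  moreover have "filter_mset (\<lambda>x. \<kappa> x = k z) (pr z) = pr z"
    using pr(2)[OF assms(1)] by (simp add: filter_mset_eq_conv)
  ultimately show ?thesis by (simp only: filter_union_mset filter_mset_mset_set mset_set.empty add_0_right)
qed

lemma size_filter_ptrans:
  assumes "K \<in> ptrans \<kappa> X"
  shows "size (filter_mset (\<lambda>x. \<kappa> x = C) (mset_set K)) \<le> 1"
proof -
  have "finite K" using assms fin by (auto simp: ptrans_def intro: finite_subset)
  moreover have "card {x \<in> K. \<kappa> x = C} \<le> 1"
    using assms by (auto simp: ptrans_def inj_on_def card_le_Suc0_iff_eq \<open>finite K\<close>)
  ultimately show ?thesis by simp
qed

text \<open>Counted with multiplicity, a double marking has two marks in one class, a single marking
  never has.\<close>

lemma single_double_disjoint: "single_marks \<kappa> X \<inter> double_marks \<kappa> X k pr Z = {}"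
proof (rule ccontr)
  assume "single_marks \<kappa> X \<inter> double_marks \<kappa> X k pr Z \<noteq> {}"
  then obtain K z K' where K: "K \<in> ptrans \<kappa> X" "z \<in> Z" "K' \<in> ptrans \<kappa> {x \<in> X. \<kappa> x \<noteq> k z}"
    "mset_set K = pr z + mset_set K'"
    by (auto simp: single_marks_def double_marks_def)
  then show False
    using filter_pair[OF K(2,3)] size_filter_ptrans[OF K(1), of "k z"] pr(1)[OF K(2)] by simp
qed

text \<open>The class of the pair is the only one with two marks. These marks form the pair, and
  \<open>pr\<close> is injective.\<close>

lemma inj_double: "inj_on (\<lambda>(z, K). pr z + mset_set K) (SIGMA z:Z. ptrans \<kappa> {x \<in> X. \<kappa> x \<noteq> k z})"
proof (rule inj_onI, clarify)
  fix z K z' K'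
  assume z: "z \<in> Z" "z' \<in> Z" and K: "K \<in> ptrans \<kappa> {x \<in> X. \<kappa> x \<noteq> k z}"
    "K' \<in> ptrans \<kappa> {x \<in> X. \<kappa> x \<noteq> k z'}" and eq: "pr z + mset_set K = pr z' + mset_set K'"
  have "finite K" "finite K'" using K fin by (auto simp: ptrans_def intro: finite_subset)
  have "k z = k z'"
  proof (rule ccontr)
    assume ne: "k z \<noteq> k z'"
    have "filter_mset (\<lambda>x. \<kappa> x = k z) (pr z') = {#}"
      using pr(2)[OF z(2)] ne by (auto simp: filter_mset_eq_mempty_iff)
    then have "pr z = filter_mset (\<lambda>x. \<kappa> x = k z) (mset_set K')"
      using filter_pair[OF z(1) K(1)] eq by (metis add_0 filter_union_mset)
    moreover have "K' \<in> ptrans \<kappa> X" using K by (auto simp: ptrans_def)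
    ultimately show False
      using size_filter_ptrans[of K' "k z"] pr(1)[OF z(1)] by simp
  qed
  then have "pr z = pr z'" using filter_pair[OF z(1) K(1)] filter_pair[OF z(2) K(2)] eq by simp
  then have "z = z'" "mset_set K = mset_set K'" using inj z eq by (auto dest: inj_onD)
  then show "z = z' \<and> K = K'" using \<open>finite K\<close> \<open>finite K'\<close> by (metis finite_set_mset_mset_set)
qed

lemma card_double_le:
  assumes "z \<in> Z" and "K \<in> ptrans \<kappa> {x \<in> X. \<kappa> x \<noteq> k z}"
  shows "Suc (card K) \<le> card \<C>"
proof -
  have "card K \<le> card (\<C> - {k z})"
    by (rule card_ptrans_le[OF _ _ assms(2)]) (use fin cls in auto)
  moreover have "k z \<in> \<C>" using assms(1) cls by auto
  moreover have "card \<C> > 0" using \<open>k z \<in> \<C>\<close> fin by (auto simp: card_gt_0_iff)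
  ultimately show ?thesis by simp
qed

text \<open>The class of the pair drops out of the product. Its two marks use up the
  \<open>Suc\<close> and the factor of this class, so the exponent that remains is the one of
  \<open>sum_ptrans\<close> for the other classes.\<close>

lemma sum_double_marks:
  fixes u :: "'a::comm_semiring_1"
  shows "(\<Sum>W\<in>double_marks \<kappa> X k pr Z. u ^ (Suc (card \<C>) - size W)) =
    (\<Sum>z\<in>Z. \<Prod>C\<in>\<C> - {k z}. u + of_nat (card {x \<in> X. \<kappa> x = C}))"
proof -
  have "(\<Sum>W\<in>double_marks \<kappa> X k pr Z. u ^ (Suc (card \<C>) - size W)) =
    (\<Sum>(z, K)\<in>(SIGMA z:Z. ptrans \<kappa> {x \<in> X. \<kappa> x \<noteq> k z}). u ^ (card (\<C> - {k z}) - card K))"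
    unfolding double_marks_def sum.reindex[OF inj_double]
  proof (rule sum.cong[OF refl], clarify)
    fix z K
    assume "z \<in> Z" "K \<in> ptrans \<kappa> {x \<in> X. \<kappa> x \<noteq> k z}"
    then show "((\<lambda>W. u ^ (Suc (card \<C>) - size W)) \<circ> (\<lambda>(z, K). pr z + mset_set K)) (z, K) =
      u ^ (card (\<C> - {k z}) - card K)"
      using pr(1) cls fin by (simp add: image_subset_iff)
  qed
  also have "\<dots> = (\<Sum>z\<in>Z. \<Sum>K\<in>ptrans \<kappa> {x \<in> X. \<kappa> x \<noteq> k z}. u ^ (card (\<C> - {k z}) - card K))"
    using fin finite_ptrans by (subst sum.Sigma) (auto intro!: finite_ptrans)
  also have "\<dots> = (\<Sum>z\<in>Z. \<Prod>C\<in>\<C> - {k z}. u + of_nat (card {x \<in> {x \<in> X. \<kappa> x \<noteq> k z}. \<kappa> x = C}))"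
    using fin cls by (intro sum.cong refl sum_ptrans) auto
  also have "\<dots> = (\<Sum>z\<in>Z. \<Prod>C\<in>\<C> - {k z}. u + of_nat (card {x \<in> X. \<kappa> x = C}))"
    by (intro sum.cong prod.cong refl) (auto intro!: arg_cong[where f = "\<lambda>A. _ + of_nat (card A)"])
  finally show ?thesis .
qed

end

section \<open>The multicomplex of marked forests\<close>

lemma edge_component_eq_iff:
  assumes "e \<in> F" "p \<in> set_uprod (g e)" "f \<in> F" "r \<in> set_uprod (g f)" "set_uprod (g f) \<subseteq> V"
  shows "edge_component g V F e = edge_component g V F f \<longleftrightarrow> conn g F p r"
proof -
  have "r \<in> V" using assms by auto
  then show ?thesis
    using edge_component_eq[of f F r g V] edge_component_eq_component_iff[of e F p g r V] assms
    by simp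
qed

lemma ex_end: "\<exists>p. p \<in> set_uprod u"
  by (cases u) auto

text \<open>\<open>Y\<close> holds the edges prescribed for every forest. For a biconing these are
  the edges that join the two copies of a split vertex, and \<open>col\<close> tells the two cones
  apart.\<close>

locale two_coloured_graph =
  fixes g :: "'e \<Rightarrow> 'w uprod" and V :: "'w set" and E Y :: "'e set" and col :: "'w \<Rightarrow> bool"
  assumes finV: "finite V" and finE: "finite E" and YE: "Y \<subseteq> E"
    and ends_V: "\<And>e. e \<in> E \<Longrightarrow> set_uprod (g e) \<subseteq> V"
begin

definition forests :: "'e set set" where
  "forests = {F. Y \<subseteq> F \<and> F \<subseteq> E \<and> forest g F}"

text \<open>Ordering by colour lets each bichromatic pair within a component occur once.\<close>

definition mixed_pairs :: "'e set \<Rightarrow> ('w \<times> 'w) set" where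
  "mixed_pairs F = {(a, b). a \<in> V \<and> b \<in> V \<and> col a \<and> \<not> col b \<and> conn g F a b}"

text \<open>The first and the last edge of the path joining the two vertices; \<open>THE\<close> is well-behaved only
  for distinct connected vertices of a forest.\<close>

definition end_edges :: "'e set \<Rightarrow> 'w \<times> 'w \<Rightarrow> 'e multiset" where
  "end_edges F = (\<lambda>(a, b). {#THE e. leaves g F e a b, THE e. leaves g F e b a#})"

definition pair_component :: "'e set \<Rightarrow> 'w \<times> 'w \<Rightarrow> 'w set" where
  "pair_component F = (\<lambda>(a, b). component g V F a)"

abbreviation ecomp :: "'e set \<Rightarrow> 'e \<Rightarrow> 'w set" where
  "ecomp \<equiv> edge_component g V"

abbreviation singles :: "'e set \<Rightarrow> 'e multiset set" where
  "singles F \<equiv> single_marks (ecomp F) F"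

abbreviation doubles :: "'e set \<Rightarrow> 'e multiset set" where
  "doubles F \<equiv> double_marks (ecomp F) F (pair_component F) (end_edges F) (mixed_pairs F)"

text \<open>An edge of \<open>Y\<close> lies in every forest, so its exponent is shifted down by one.\<close>

definition monomials :: "'e multiset set" where
  "monomials = {mset_set (F - Y) + W |F W. F \<in> forests \<and> W \<in> singles F \<union> doubles F}"

lemma forestsD:
  assumes "F \<in> forests"
  shows "Y \<subseteq> F" "F \<subseteq> E" "forest g F" "finite F" "\<And>e. e \<in> F \<Longrightarrow> set_uprod (g e) \<subseteq> V"
  using assms ends_V finE by (auto simp: forests_def intro: finite_subset)

lemma ecomp_eq_iff:
  assumes "F \<in> forests" and "e \<in> F" "p \<in> set_uprod (g e)" "f \<in> F" "r \<in> set_uprod (g f)"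
  shows "ecomp F e = ecomp F f \<longleftrightarrow> conn g F p r"
  using edge_component_eq_iff[of e F p g f r V] forestsD(5) assms by blast

lemma the_leaves: "forest g F \<Longrightarrow> leaves g F e u v \<Longrightarrow> (THE e. leaves g F e u v) = e"
  using leaves_unique[of g F] by (intro the_equality) auto

lemma mixed_pair_leaves:
  assumes "F \<in> forests" and "(a, b) \<in> mixed_pairs F"
  obtains e f where "leaves g F e a b" "leaves g F f b a" "end_edges F (a, b) = {#e, f#}"
proof -
  have "a \<noteq> b" "conn g F a b" "conn g F b a"
    using assms(2) conn_sym by (auto simp: mixed_pairs_def)
  then obtain e f where "leaves g F e a b" "leaves g F f b a"
    using ex_leaves[of F g] forestsD[OF assms(1)] by metis
  then show ?thesis
    using that the_leaves forestsD(3)[OF assms(1)] by (simp add: end_edges_def)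
qed

lemma ecomp_leaves: "leaves g F e a b \<Longrightarrow> ecomp F e = component g V F a"
  using edge_component_eq[of e F a g V] by (auto simp: leaves_def)

lemma component_conn: "conn g F a b \<Longrightarrow> component g V F a = component g V F b"
  unfolding component_def using conn_trans[of g F] conn_sym[of g F] by blast

text \<open>The main point is that the end edges of a path determine the pair \<open>(a, b)\<close>:
  \<open>leaves_pair_ends\<close> leaves only a swap of the two vertices open, and their colours
  exclude it.\<close>

lemma marked_pairs_forest:
  assumes F: "F \<in> forests"
  shows "marked_pairs (components g V F) F (ecomp F) (mixed_pairs F) (pair_component F) (end_edges F)"
proof
  show "finite (components g V F)" using finV by (simp add: components_def)
  show "finite F" by (rule forestsD(4)[OF F])
  show "finite (mixed_pairs F)"
    by (rule finite_subset[of _ "V \<times> V"]) (use finV in \<open>auto simp: mixed_pairs_def\<close>)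
  show "ecomp F ` F \<subseteq> components g V F"
    using edge_component_in_components[of _ F g V] forestsD(5)[OF F] by blast
  show "pair_component F ` mixed_pairs F \<subseteq> components g V F"
    by (auto simp: pair_component_def mixed_pairs_def components_def)
  show "inj_on (end_edges F) (mixed_pairs F)"
  proof (rule inj_onI, clarify)
    fix a b a' b'
    assume m: "(a, b) \<in> mixed_pairs F" "(a', b') \<in> mixed_pairs F"
      and eq: "end_edges F (a, b) = end_edges F (a', b')"
    obtain e f where ef: "leaves g F e a b" "leaves g F f b a" "end_edges F (a, b) = {#e, f#}"
      by (rule mixed_pair_leaves[OF F m(1)])
    obtain e' f' where ef': "leaves g F e' a' b'" "leaves g F f' b' a'"
      "end_edges F (a', b') = {#e', f'#}"
      by (rule mixed_pair_leaves[OF F m(2)])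
    have cols: "col a" "\<not> col b" "col a'" "\<not> col b'" using m by (auto simp: mixed_pairs_def)
    have "e = e' \<and> f = f' \<or> e = f' \<and> f = e'"
      using eq ef(3) ef'(3) by (auto simp: add_eq_conv_ex)
    then show "a = a' \<and> b = b'"
      using leaves_pair_ends[OF forestsD(3)[OF F] ef(1,2)] ef'(1,2) cols by metis
  qed
  fix z
  assume z: "z \<in> mixed_pairs F"
  obtain a b where ab: "z = (a, b)" by (cases z)
  obtain e f where ef: "leaves g F e a b" "leaves g F f b a" "end_edges F (a, b) = {#e, f#}"
    using mixed_pair_leaves[OF F] z ab by blast
  show "size (end_edges F z) = 2" using ab ef(3) by simp
  fix x
  assume "x \<in># end_edges F z"
  moreover have "ecomp F e = pair_component F z" "ecomp F f = pair_component F z" "e \<in> F" "f \<in> F"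
    using ab ef(1,2) ecomp_leaves[OF ef(1)] ecomp_leaves[OF ef(2)] component_conn[of F a b]
    by (auto simp: pair_component_def leaves_def)
  ultimately show "x \<in> F \<and> ecomp F x = pair_component F z" using ab ef(3) by auto
qed

section \<open>Closure under divisors\<close>

lemma in_singles_iff: "W \<in> singles F \<longleftrightarrow> (\<exists>K\<subseteq>F. inj_on (ecomp F) K \<and> W = mset_set K)"
  by (auto simp: single_marks_def ptrans_def)

lemma singlesI: "K \<subseteq> F \<Longrightarrow> inj_on (ecomp F) K \<Longrightarrow> mset_set K \<in> singles F"
  by (auto simp: single_marks_def ptrans_def)

text \<open>Eliminates \<open>THE\<close> in favour of \<open>leaves\<close>. The component of the
  pair is expressed by \<open>e\<close>; that of \<open>f\<close> is the same.\<close>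

lemma in_doubles_iff:
  assumes F: "F \<in> forests"
  shows "W \<in> doubles F \<longleftrightarrow> (\<exists>a b e f K. a \<in> V \<and> b \<in> V \<and> col a \<and> \<not> col b \<and> leaves g F e a b \<and>
    leaves g F f b a \<and> K \<subseteq> F \<and> inj_on (ecomp F) K \<and> ecomp F e \<notin> ecomp F ` K \<and>
    W = add_mset e (add_mset f (mset_set K)))" (is "_ \<longleftrightarrow> ?R")
proof
  assume "W \<in> doubles F"
  then obtain a b K where K: "(a, b) \<in> mixed_pairs F"
    "K \<in> ptrans (ecomp F) {x \<in> F. ecomp F x \<noteq> pair_component F (a, b)}"
    "W = end_edges F (a, b) + mset_set K"
    by (auto simp: double_marks_def)
  obtain e f where ef: "leaves g F e a b" "leaves g F f b a" "end_edges F (a, b) = {#e, f#}"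
    by (rule mixed_pair_leaves[OF F K(1)])
  have "a \<in> V \<and> b \<in> V \<and> col a \<and> \<not> col b" using K(1) by (simp add: mixed_pairs_def)
  moreover have "K \<subseteq> F" "inj_on (ecomp F) K" "ecomp F e \<notin> ecomp F ` K"
    using K(2) ecomp_leaves[OF ef(1)] by (auto simp: ptrans_def pair_component_def)
  moreover have "W = add_mset e (add_mset f (mset_set K))" using K(3) ef(3) by simp
  ultimately show ?R using ef(1,2) by blast
next
  assume ?R
  then obtain a b e f K where *: "a \<in> V" "b \<in> V" "col a" "\<not> col b" "leaves g F e a b"
    "leaves g F f b a" "K \<subseteq> F" "inj_on (ecomp F) K" "ecomp F e \<notin> ecomp F ` K"
    "W = add_mset e (add_mset f (mset_set K))"
    by blast
  have "end_edges F (a, b) = {#e, f#}"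
    using the_leaves *(5,6) forestsD(3)[OF F] by (simp add: end_edges_def)
  moreover have "(a, b) \<in> mixed_pairs F"
    using * by (auto simp: mixed_pairs_def leaves_def)
  moreover have "K \<in> ptrans (ecomp F) {x \<in> F. ecomp F x \<noteq> pair_component F (a, b)}"
    using * ecomp_leaves[OF *(5)] by (auto simp: ptrans_def pair_component_def)
  ultimately show "W \<in> doubles F"
    unfolding double_marks_def using *(10) by (intro image_eqI[of _ _ "((a, b), K)"]) auto
qed

lemma marks_subset:
  assumes "F \<in> forests" and "W \<in> singles F \<union> doubles F"
  shows "set_mset W \<subseteq> F"
proof -
  have "K \<subseteq> F \<Longrightarrow> set_mset (mset_set K) = K" for K
    using forestsD(4)[OF assms(1)] by (simp add: finite_subset)
  then show ?thesis
    using assms(2) by (auto simp: in_singles_iff in_doubles_iff[OF assms(1)] leaves_def)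
qed

lemma mset_set_eq_add_mset:
  assumes "finite K" and "add_mset x W = mset_set K"
  shows "x \<in> K \<and> W = mset_set (K - {x})"
proof -
  have "x \<in> K" using assms by (metis finite_set_mset_mset_set union_single_eq_member)
  moreover have "W = mset_set K - {#x#}" using assms(2) by (metis add_mset_remove_trivial)
  ultimately show ?thesis using assms(1) by (simp add: mset_set_Diff)
qed

lemma ecomp_pair:
  assumes "F \<in> forests" "leaves g F e a b" "leaves g F f b a"
  shows "ecomp F f = ecomp F e"
  using ecomp_leaves[OF assms(2)] ecomp_leaves[OF assms(3)] component_conn assms(2)
  by (auto simp: leaves_def)

text \<open>Without one of its two marks a pair becomes an ordinary mark and the marking single;
  removing any other mark does not change the kind of the marking.\<close>

lemma marks_remove:
  assumes F: "F \<in> forests" and W: "add_mset x W \<in> singles F \<union> doubles F"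
  shows "W \<in> singles F \<union> doubles F"
proof (cases "add_mset x W \<in> singles F")
  case True
  then obtain K where K: "K \<subseteq> F" "inj_on (ecomp F) K" "add_mset x W = mset_set K"
    by (auto simp: in_singles_iff)
  then have "W = mset_set (K - {x})"
    using mset_set_eq_add_mset forestsD(4)[OF F] finite_subset by metis
  then show ?thesis
    using K by (auto simp: in_singles_iff intro!: exI[of _ "K - {x}"] inj_on_diff)
next
  case False
  then obtain a b e f K where *: "a \<in> V" "b \<in> V" "col a" "\<not> col b" "leaves g F e a b"
    "leaves g F f b a" "K \<subseteq> F" "inj_on (ecomp F) K" "ecomp F e \<notin> ecomp F ` K"
    "add_mset x W = add_mset e (add_mset f (mset_set K))"
    using W in_doubles_iff[OF F] by blast
  have finK: "finite K" using *(7) forestsD(4)[OF F] by (rule finite_subset)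
  have ef: "ecomp F f = ecomp F e" by (rule ecomp_pair[OF F *(5,6)])
  have insK: "mset_set (insert h K) \<in> singles F" if "h \<in> {e, f}" for h
  proof -
    have "h \<in> F" "ecomp F h = ecomp F e" using that ef *(5,6) by (auto simp: leaves_def)
    moreover have "inj_on (ecomp F) (insert h K)"
    proof -
      have "ecomp F h \<notin> ecomp F ` (K - {h})" using *(9) calculation(2) by auto
      then show ?thesis using *(8) by simp
    qed
    moreover have "insert h K \<subseteq> F" using calculation(1) *(7) by simp
    ultimately show ?thesis by (intro singlesI)
  qed
  have "e \<notin> K" "f \<notin> K" using *(9) ef by (metis imageI)+
  then have ins: "add_mset e (mset_set K) \<in> singles F" "add_mset f (mset_set K) \<in> singles F"
    using insK[of e] insK[of f] finK by simp_all
  consider "x = e" | "x = f" | "x \<noteq> e" "x \<noteq> f" "x \<in> K"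
    using *(10) finK by (metis finite_set_mset_mset_set insert_iff set_mset_add_mset_insert union_single_eq_member)
  then show ?thesis
  proof cases
    case 1
    then show ?thesis using *(10) ins by simp
  next
    case 2
    then have "W = add_mset e (mset_set K)" using *(10) by (simp add: add_mset_commute)
    then show ?thesis using ins by simp
  next
    case 3
    have "mset_set K = add_mset x (mset_set (K - {x}))"
      using 3(3) finK by (simp add: mset_set.remove)
    then have "add_mset x W = add_mset x (add_mset e (add_mset f (mset_set (K - {x}))))"
      using *(10) by (simp add: add_mset_commute)
    then have "W = add_mset e (add_mset f (mset_set (K - {x})))" by simp
    moreover have "K - {x} \<subseteq> F" "inj_on (ecomp F) (K - {x})" "ecomp F e \<notin> ecomp F ` (K - {x})"
      using *(7,8,9) by (auto intro: inj_on_diff)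
    ultimately have "W \<in> doubles F" using in_doubles_iff[OF F] *(1-6) by blast
    then show ?thesis by blast
  qed
qed

lemma ecomp_refine:
  assumes "F \<in> forests" "F' \<in> forests" "F' \<subseteq> F" "e \<in> F'" "f \<in> F'" "ecomp F' e = ecomp F' f"
  shows "ecomp F e = ecomp F f"
proof -
  obtain p r where "p \<in> set_uprod (g e)" "r \<in> set_uprod (g f)" using ex_end by metis
  then show ?thesis
    using ecomp_eq_iff[OF assms(1), of e p f r] ecomp_eq_iff[OF assms(2), of e p f r]
      conn_mono[OF assms(3), of g p r] assms(3-6) by blast
qed

text \<open>Components of \<open>F'\<close> refine those of \<open>F\<close>, so separate marks stay
  separate. If \<open>a\<close> and \<open>b\<close> are still connected, \<open>e\<close> and
  \<open>f\<close> are still the end edges of their path. Otherwise \<open>e\<close> and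
  \<open>f\<close> now lie in different components, and the marking becomes single.\<close>

lemma marks_delete:
  assumes F: "F \<in> forests" "F' \<in> forests" "F' \<subseteq> F" and W: "W \<in> singles F \<union> doubles F"
    and sub: "set_mset W \<subseteq> F'"
  shows "W \<in> singles F' \<union> doubles F'"
proof -
  have inj: "inj_on (ecomp F') K" if "inj_on (ecomp F) K" "K \<subseteq> F'" for K
  proof (rule inj_onI)
    fix x y
    assume "x \<in> K" "y \<in> K" "ecomp F' x = ecomp F' y"
    then show "x = y" using that ecomp_refine[OF F, of x y] by (auto dest: inj_onD)
  qed
  show ?thesis
  proof (cases "W \<in> singles F")
    case True
    then obtain K where K: "K \<subseteq> F" "inj_on (ecomp F) K" "W = mset_set K"
      by (auto simp: in_singles_iff)
    then have "K \<subseteq> F'" using sub forestsD(4)[OF F(1)] by (simp add: finite_subset)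
    then show ?thesis using K inj by (auto simp: in_singles_iff)
  next
    case False
    then obtain a b e f K where *: "a \<in> V" "b \<in> V" "col a" "\<not> col b" "leaves g F e a b"
      "leaves g F f b a" "K \<subseteq> F" "inj_on (ecomp F) K" "ecomp F e \<notin> ecomp F ` K"
      "W = add_mset e (add_mset f (mset_set K))"
      using W in_doubles_iff[OF F(1)] by blast
    have finK: "finite K" using *(7) forestsD(4)[OF F(1)] by (rule finite_subset)
    have "set_mset W = insert e (insert f K)" using finK *(10) by simp
    then have F': "e \<in> F'" "f \<in> F'" "K \<subseteq> F'" using sub by simp_all
    have ends: "a \<in> set_uprod (g e)" "b \<in> set_uprod (g f)" using *(5,6) by (auto simp: leaves_def)
    have ef: "ecomp F f = ecomp F e" by (rule ecomp_pair[OF F(1) *(5,6)])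
    have "ecomp F' h \<notin> ecomp F' ` K" if "h \<in> F'" "ecomp F h = ecomp F e" for h
    proof
      assume "ecomp F' h \<in> ecomp F' ` K"
      then obtain x where "x \<in> K" "ecomp F' h = ecomp F' x" by blast
      then have "ecomp F h = ecomp F x" using ecomp_refine[OF F that(1)] F'(3) by blast
      then show False using *(9) that(2) \<open>x \<in> K\<close> by simp
    qed
    then have nK: "ecomp F' e \<notin> ecomp F' ` K" "ecomp F' f \<notin> ecomp F' ` K" using F' ef by auto
    show ?thesis
    proof (cases "ecomp F' e = ecomp F' f")
      case True
      then have c: "conn g F' a b" using ecomp_eq_iff[OF F(2) F'(1) ends(1) F'(2) ends(2)] by simp
      have "leaves g F' e a b" "leaves g F' f b a"
        using leaves_antimono[OF *(5) F(3) F'(1) c] leaves_antimono[OF *(6) F(3) F'(2) conn_sym[OF c]]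
        by auto
      then have "W \<in> doubles F'"
        using in_doubles_iff[OF F(2)] *(1-4,10) F'(3) nK(1) inj[OF *(8)] by blast
      then show ?thesis by blast
    next
      case False
      then have "e \<noteq> f" by auto
      have "e \<notin> K" "f \<notin> K" using nK by auto
      then have "W = mset_set (insert e (insert f K))"
        using *(10) finK \<open>e \<noteq> f\<close> by simp
      moreover have "inj_on (ecomp F') (insert e (insert f K))"
        using inj[OF *(8) F'(3)] nK False by auto
      moreover have "insert e (insert f K) \<subseteq> F'" using F' by simp
      ultimately have "W \<in> singles F'" using singlesI[of "insert e (insert f K)" F'] by simp
      then show ?thesis by blast
    qed
  qed
qed

lemma forests_Diff: "F \<in> forests \<Longrightarrow> x \<notin> Y \<Longrightarrow> F - {x} \<in> forests"
  using forest_subset[of g F "F - {x}"] by (auto simp: forests_def)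

text \<open>If \<open>x\<close> occurs in \<open>W\<close>, a mark is removed. If not,
  \<open>x\<close> is an unmarked edge outside \<open>Y\<close>, and deleting it from the forest
  leaves all marks inside the forest.\<close>

lemma monomials_remove:
  assumes "add_mset x m \<in> monomials"
  shows "m \<in> monomials"
proof -
  obtain F W where F: "F \<in> forests" "W \<in> singles F \<union> doubles F"
    "add_mset x m = mset_set (F - Y) + W"
    using assms by (auto simp: monomials_def)
  have fin: "finite (F - Y)" using forestsD(4)[OF F(1)] by simp
  show ?thesis
  proof (cases "x \<in># W")
    case True
    then obtain W' where W': "W = add_mset x W'" by (metis insert_DiffM)
    then have "m = mset_set (F - Y) + W'" using F(3) by simp
    moreover have "W' \<in> singles F \<union> doubles F" using marks_remove F W' by blast
    ultimately show ?thesis using F(1) by (auto simp: monomials_def)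
  next
    case False
    have "x \<in># mset_set (F - Y) + W" unfolding F(3)[symmetric] by simp
    then have x: "x \<in> F - Y" using False fin by simp
    then have "mset_set (F - Y) = add_mset x (mset_set (F - Y - {x}))"
      using fin by (simp add: mset_set.remove)
    moreover have "F - Y - {x} = F - {x} - Y" by auto
    ultimately have m: "m = mset_set (F - {x} - Y) + W" using F(3) by simp
    have F': "F - {x} \<in> forests" using forests_Diff F(1) x by blast
    have "W \<in> singles (F - {x}) \<union> doubles (F - {x})"
      using marks_delete[OF F(1) F' _ F(2)] marks_subset[OF F(1,2)] False by blast
    then show ?thesis using m F' by (auto simp: monomials_def)
  qed
qed

lemma monomials_subset:
  assumes "m \<in> monomials" and "m' \<subseteq># m"
  shows "m' \<in> monomials"
proof -
  have "m' + d \<in> monomials \<Longrightarrow> m' \<in> monomials" for d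
  proof (induction d)
    case (add x d)
    then show ?case using monomials_remove[of x "m' + d"] by simp
  qed simp
  then show ?thesis using assms by (metis subset_mset.add_diff_inverse)
qed

lemma multicomplex_monomials: "multicomplex_on E monomials"
proof -
  have "set_mset m \<subseteq> E" if m: "m \<in> monomials" for m
  proof -
    obtain F W where F: "F \<in> forests" "W \<in> singles F \<union> doubles F" "m = mset_set (F - Y) + W"
      using m by (auto simp: monomials_def)
    then show ?thesis
      using marks_subset[OF F(1,2)] forestsD(2,4)[OF F(1)] by auto
  qed
  then show ?thesis using finE monomials_subset by (auto simp: multicomplex_on_def)
qed

section \<open>Counting the monomials by degree\<close>

lemma finite_forests: "finite forests"
  by (rule finite_subset[of _ "Pow E"]) (use finE in \<open>auto simp: forests_def\<close>)

lemma finite_singles: "F \<in> forests \<Longrightarrow> finite (singles F)"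
  using forestsD(4) by (auto simp: single_marks_def intro: finite_ptrans)

lemma finite_doubles: "F \<in> forests \<Longrightarrow> finite (doubles F)"
  unfolding double_marks_def
  using forestsD(4)[of F] marked_pairs.fin(3)[OF marked_pairs_forest[of F]]
  by (intro finite_imageI finite_SigmaI finite_ptrans) auto

lemma card_forest_components: "F \<in> forests \<Longrightarrow> card F + card (components g V F) = card V"
  using card_forest[of F V g] forestsD finV by blast

lemma size_single: "F \<in> forests \<Longrightarrow> W \<in> singles F \<Longrightarrow> size W \<le> card (components g V F)"
  using marked_pairs.fin(1)[OF marked_pairs_forest[of F]]
    marked_pairs.cls(1)[OF marked_pairs_forest[of F]]
  by (auto simp: single_marks_def intro: card_ptrans_le[where \<kappa> = "ecomp F" and X = F])

lemma size_double:
  assumes "F \<in> forests" and "W \<in> doubles F"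
  shows "size W \<le> Suc (card (components g V F))"
  using assms(2) marked_pairs.card_double_le[OF marked_pairs_forest[OF assms(1)]]
    marked_pairs.pr(1)[OF marked_pairs_forest[OF assms(1)]]
  by (fastforce simp: double_marks_def)

text \<open>Since \<open>card F\<close> is \<open>card V\<close> minus the number of components, the
  first expression depends on the marks and the number of components alone. The second claim ensures
  that the subtraction from the top degree is not truncated.\<close>

lemma size_monomial:
  assumes "F \<in> forests" and "W \<in> singles F \<union> doubles F"
  shows "card V - card Y + 1 - size (mset_set (F - Y) + W) = Suc (card (components g V F)) - size W"
    and "size (mset_set (F - Y) + W) \<le> card V - card Y + 1"
proof -
  have "card (F - Y) = card F - card Y" "card Y \<le> card F"
    using forestsD(1,4)[OF assms(1)] by (auto intro: card_Diff_subset card_mono finite_subset)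
  moreover have "size W \<le> Suc (card (components g V F))"
    using size_single size_double assms by fastforce
  moreover note card_forest_components[OF assms(1)]
  ultimately show "card V - card Y + 1 - size (mset_set (F - Y) + W) =
      Suc (card (components g V F)) - size W"
    "size (mset_set (F - Y) + W) \<le> card V - card Y + 1"
    by simp_all
qed

lemma sum_monomials:
  fixes t :: "'a::comm_semiring_1"
  shows "(\<Sum>m\<in>monomials. t ^ (card V - card Y + 1 - size m)) =
    (\<Sum>F\<in>forests.
      t * (\<Prod>C\<in>components g V F. t + of_nat (card {e \<in> F. ecomp F e = C})) +
      (\<Sum>z\<in>mixed_pairs F. \<Prod>C\<in>components g V F - {pair_component F z}.
        t + of_nat (card {e \<in> F. ecomp F e = C})))"
proof -
  let ?f = "\<lambda>(F, W). mset_set (F - Y) + W"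
  let ?S = "SIGMA F:forests. singles F \<union> doubles F"
  have "inj_on ?f ?S"
  proof (rule inj_onI, clarify)
    fix F W F' W'
    assume F: "F \<in> forests" "F' \<in> forests" and W: "W \<in> singles F \<union> doubles F"
      "W' \<in> singles F' \<union> doubles F'" and eq: "mset_set (F - Y) + W = mset_set (F' - Y) + W'"
    \<comment> \<open>The marks lie in \<open>F\<close>, so \<open>F\<close> is recovered as the
      support of the monomial together with \<open>Y\<close>, and then \<open>W\<close> by
      cancellation.\<close>
    have "Y \<union> set_mset (mset_set (F - Y) + W) = F" if "F \<in> forests" "W \<in> singles F \<union> doubles F" for F W
      using marks_subset[OF that] forestsD(1,4)[OF that(1)] by auto
    then have "F = F'" using F W eq by metis
    then show "F = F' \<and> W = W'" using eq by simp
  qed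
  moreover have "monomials = ?f ` ?S" by (auto simp: monomials_def)
  ultimately have "(\<Sum>m\<in>monomials. t ^ (card V - card Y + 1 - size m)) =
      (\<Sum>(F, W)\<in>?S. t ^ (Suc (card (components g V F)) - size W))"
    using size_monomial(1) by (simp add: sum.reindex) (intro sum.cong, auto)
  also have "\<dots> = (\<Sum>F\<in>forests. \<Sum>W\<in>singles F \<union> doubles F. t ^ (Suc (card (components g V F)) - size W))"
    using finite_forests finite_singles finite_doubles by (subst sum.Sigma) auto
  also have "\<dots> = (\<Sum>F\<in>forests.
      t * (\<Prod>C\<in>components g V F. t + of_nat (card {e \<in> F. ecomp F e = C})) +
      (\<Sum>z\<in>mixed_pairs F. \<Prod>C\<in>components g V F - {pair_component F z}.
        t + of_nat (card {e \<in> F. ecomp F e = C})))"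
  proof (rule sum.cong[OF refl])
    fix F
    assume F: "F \<in> forests"
    interpret marked_pairs "components g V F" F "ecomp F" "mixed_pairs F" "pair_component F" "end_edges F"
      by (rule marked_pairs_forest[OF F])
    \<comment> \<open>A single marking has at most one mark per component, while the exponent allows
      for one more; this leaves a factor \<open>t\<close>.\<close>
    have "(\<Sum>W\<in>singles F. t ^ (Suc (card (components g V F)) - size W)) =
        t * (\<Sum>W\<in>singles F. t ^ (card (components g V F) - size W))"
      unfolding sum_distrib_left
      using size_single[OF F] by (intro sum.cong) (auto simp: Suc_diff_le)
    then show "(\<Sum>W\<in>singles F \<union> doubles F. t ^ (Suc (card (components g V F)) - size W)) =
      t * (\<Prod>C\<in>components g V F. t + of_nat (card {e \<in> F. ecomp F e = C})) +
      (\<Sum>z\<in>mixed_pairs F. \<Prod>C\<in>components g V F - {pair_component F z}.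
        t + of_nat (card {e \<in> F. ecomp F e = C}))"
      using single_double_disjoint finite_singles[OF F] finite_doubles[OF F]
        sum_single_marks[OF fin(1,2) cls(1), of t] sum_double_marks[of t]
      by (simp add: sum.union_disjoint)
  qed
  finally show ?thesis .
qed

text \<open>The hypothesis \<open>cov\<close>, that every component with an edge carries a mark,
  will be shown for maximal monomials. Each such component then has exactly one mark, except that
  the component of a pair has two.\<close>

lemma size_facet_marks:
  assumes F: "F \<in> forests" and "W \<in> singles F \<union> doubles F" and cov: "ecomp F ` set_mset W = ecomp F ` F"
  shows "size W = card (ecomp F ` F) + (if W \<in> doubles F then 1 else 0)"
proof (cases "W \<in> doubles F")
  case True
  then obtain a b e f K where *: "leaves g F e a b" "leaves g F f b a" "K \<subseteq> F" "inj_on (ecomp F) K"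
    "ecomp F e \<notin> ecomp F ` K" "W = add_mset e (add_mset f (mset_set K))"
    using in_doubles_iff[OF F] by blast
  have finK: "finite K" using *(3) forestsD(4)[OF F] by (rule finite_subset)
  have "ecomp F ` set_mset W = insert (ecomp F e) (ecomp F ` K)"
    using *(6) finK ecomp_pair[OF F *(1,2)] by simp
  then have "card (ecomp F ` F) = Suc (card K)"
    using *(4,5) finK cov by (simp add: card_image)
  then show ?thesis using True *(6) by simp
next
  case False
  then obtain K where K: "K \<subseteq> F" "inj_on (ecomp F) K" "W = mset_set K"
    using assms(2) by (auto simp: in_singles_iff)
  have "finite K" using K(1) forestsD(4)[OF F] by (rule finite_subset)
  then show ?thesis using False K cov by (simp add: card_image flip: cov)
qed

text \<open>Loops lie in no forest, so a vertex whose only edges are loops counts as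
  isolated.\<close>

definition isolated :: "'w set" where
  "isolated = {x \<in> V. \<forall>e\<in>E. x \<in> set_uprod (g e) \<longrightarrow> g e = Upair x x}"

lemma no_loops: "F \<in> forests \<Longrightarrow> e \<in> F \<Longrightarrow> g e \<noteq> Upair x x"
  using forestD[of g F e x x] forestsD(3) by auto

text \<open>A component either contains an edge or is a single vertex that \<open>F\<close> does not
  cover.\<close>

lemma card_nontrivial_components:
  assumes F: "F \<in> forests"
  shows "card (components g V F) =
    card (ecomp F ` F) + card {x \<in> V. \<forall>e\<in>F. x \<notin> set_uprod (g e)}"
proof -
  let ?I = "{x \<in> V. \<forall>e\<in>F. x \<notin> set_uprod (g e)}"
  have single: "component g V F x = {x}" if "x \<in> ?I" for x
    using conn_isolated[of g F x] that by (auto simp: component_def)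
  have "components g V F = ecomp F ` F \<union> (\<lambda>x. {x}) ` ?I"
  proof (intro equalityI subsetI)
    fix C
    assume "C \<in> components g V F"
    then obtain x where x: "x \<in> V" "C = component g V F x" by (auto simp: components_def)
    show "C \<in> ecomp F ` F \<union> (\<lambda>x. {x}) ` ?I"
    proof (cases "x \<in> ?I")
      case True
      then show ?thesis using single x by blast
    next
      case False
      then obtain e where "e \<in> F" "x \<in> set_uprod (g e)" using x by blast
      then show ?thesis using edge_component_eq[of e F x g V] x by blast
    qed
  next
    fix C
    assume "C \<in> ecomp F ` F \<union> (\<lambda>x. {x}) ` ?I"
    then show "C \<in> components g V F"
    proof
      assume "C \<in> ecomp F ` F"
      then show ?thesis
        using edge_component_in_components[of _ F g V] forestsD(5)[OF F] by blast
    next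
      assume "C \<in> (\<lambda>x. {x}) ` ?I"
      then obtain x where "x \<in> ?I" "C = {x}" by blast
      then show ?thesis using single[of x] by (auto simp: components_def)
    qed
  qed
  moreover have "ecomp F ` F \<inter> (\<lambda>x. {x}) ` ?I = {}"
  proof (rule ccontr)
    assume "ecomp F ` F \<inter> (\<lambda>x. {x}) ` ?I \<noteq> {}"
    then obtain e x where ex: "e \<in> F" "ecomp F e = {x}" "\<forall>e\<in>F. x \<notin> set_uprod (g e)" by blast
    obtain p where p: "p \<in> set_uprod (g e)" using ex_end by metis
    then have "p \<in> ecomp F e" using forestsD(5)[OF F ex(1)] by (auto simp: edge_component_def)
    then show False using ex p by auto
  qed
  moreover have "card ((\<lambda>x. {x}) ` ?I) = card ?I" by (intro card_image) auto
  ultimately show ?thesis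
    using forestsD(4)[OF F] finV by (simp add: card_Un_disjoint)
qed

lemma ex_bichromatic_edge:
  assumes "conn g F a b" and "col a" and "\<not> col b"
  shows "\<exists>e\<in>F. \<exists>x y. g e = Upair x y \<and> col x \<and> \<not> col y"
proof -
  have "col b \<or> ?thesis"
    using assms(1)
  proof (induction rule: conn_induct)
    case refl
    then show ?case using assms(2) by simp
  next
    case (step y z e)
    then show ?case by blast
  qed
  then show ?thesis using assms(3) by simp
qed

end

section \<open>Purity\<close>

text \<open>Deleting the bridge \<open>e\<close> separates its ends, so one of them is cut off from
  \<open>z\<close>; from that end the path to \<open>z\<close> starts with \<open>e\<close>.\<close>

lemma ex_leaves_at:
  assumes "forest g F" and "e \<in> F" and "p \<in> set_uprod (g e)" and "conn g F p z"
  shows "\<exists>u. leaves g F e u z"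
proof -
  obtain q where e: "g e = Upair p q" using assms(3) mem_ends by metis
  have nc: "\<not> conn g (F - {e}) p q" using forestD[of g F e p q] assms e by blast
  have conn_q: "conn g F q z"
    using conn_edge[of e F g p q] assms(2,4) e conn_sym conn_trans by metis
  show ?thesis
  proof (cases "conn g (F - {e}) p z")
    case True
    then have "\<not> conn g (F - {e}) q z" using nc conn_sym conn_trans by metis
    then show ?thesis using assms(2) e conn_q by (auto simp: leaves_def)
  next
    case False
    then show ?thesis using assms by (auto simp: leaves_def)
  qed
qed

lemma inj_on_coarsen:
  assumes "inj_on f K" and "\<And>x y. x \<in> K \<Longrightarrow> y \<in> K \<Longrightarrow> h x = h y \<Longrightarrow> f x = f y"
  shows "inj_on h K"
  using assms unfolding inj_on_def by blast

context two_coloured_graph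
begin

text \<open>Introduction rule that is symmetric in the colours; the order of the two marks does not
  matter in a multiset.\<close>

lemma doublesI:
  assumes F: "F \<in> forests" and "leaves g F e u z" "leaves g F f z u" "u \<in> V" "z \<in> V" "col u \<noteq> col z"
    and "K \<subseteq> F" "inj_on (ecomp F) K" "ecomp F e \<notin> ecomp F ` K"
  shows "add_mset e (add_mset f (mset_set K)) \<in> doubles F"
proof (cases "col u")
  case True
  then show ?thesis using in_doubles_iff[OF F] assms by blast
next
  case False
  have "ecomp F f \<notin> ecomp F ` K" using ecomp_pair[OF F assms(2,3)] assms(9) by simp
  then have "add_mset f (add_mset e (mset_set K)) \<in> doubles F"
    using in_doubles_iff[OF F] assms False by blast
  then show ?thesis by (simp add: add_mset_commute)
qed

lemma leaves_in_V: "F \<in> forests \<Longrightarrow> leaves g F e u z \<Longrightarrow> u \<in> V \<and> z \<in> V"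
  using forestsD(5)[of F e] conn_closed[of g F u z V] forestsD(5)[of F] by (auto simp: leaves_def)

text \<open>By \<open>sep\<close> the new edge does not bring marks of different components
  together, so the conditions on components persist. The end edges of the path persist by
  \<open>leaves_mono\<close>.\<close>

lemma marks_insert:
  assumes F: "F \<in> forests" and F': "insert x F \<in> forests" and W: "W \<in> singles F \<union> doubles F"
    and sep: "\<And>e f. e \<in> set_mset W \<Longrightarrow> f \<in> set_mset W \<Longrightarrow> ecomp (insert x F) e = ecomp (insert x F) f \<Longrightarrow>
      ecomp F e = ecomp F f"
  shows "W \<in> singles (insert x F) \<union> doubles (insert x F)"
proof -
  have finK: "K \<subseteq> F \<Longrightarrow> finite K" for K using forestsD(4)[OF F] finite_subset by blast
  show ?thesis
  proof (cases "W \<in> singles F")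
    case True
    then obtain K where K: "K \<subseteq> F" "inj_on (ecomp F) K" "W = mset_set K"
      by (auto simp: in_singles_iff)
    have "set_mset W = K" using K finK by simp
    then have "inj_on (ecomp (insert x F)) K"
      using inj_on_coarsen[OF K(2), of "ecomp (insert x F)"] sep by blast
    then show ?thesis using K singlesI[of K "insert x F"] by auto
  next
    case False
    then obtain a b e f K where *: "a \<in> V" "b \<in> V" "col a" "\<not> col b" "leaves g F e a b"
      "leaves g F f b a" "K \<subseteq> F" "inj_on (ecomp F) K" "ecomp F e \<notin> ecomp F ` K"
      "W = add_mset e (add_mset f (mset_set K))"
      using W in_doubles_iff[OF F] by blast
    have set: "set_mset W = insert e (insert f K)" using *(7,10) finK by simp
    have "inj_on (ecomp (insert x F)) K"
      using inj_on_coarsen[OF *(8), of "ecomp (insert x F)"] sep set by blast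
    moreover have "ecomp (insert x F) e \<notin> ecomp (insert x F) ` K"
    proof
      assume "ecomp (insert x F) e \<in> ecomp (insert x F) ` K"
      then obtain h where "h \<in> K" "ecomp (insert x F) e = ecomp (insert x F) h" by blast
      then have "ecomp F e = ecomp F h" using sep set by simp
      then show False using *(9) \<open>h \<in> K\<close> by simp
    qed
    moreover have "leaves g (insert x F) e a b" "leaves g (insert x F) f b a"
      using leaves_mono[of g F _ _ _ "insert x F"] *(5,6) forestsD(3)[OF F'] by blast+
    ultimately have "W \<in> doubles (insert x F)"
      using doublesI[OF F', of e a b f K] * by auto
    then show ?thesis by blast
  qed
qed

lemma facetD: "m \<in> facets monomials \<Longrightarrow> add_mset x m \<notin> monomials"
  unfolding facets_def by (auto dest: bspec[where x = "add_mset x m"])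

lemma monomials_insert_edge:
  assumes "F \<in> forests" "insert x F \<in> forests" "x \<notin> F"
    and "W \<in> singles (insert x F) \<union> doubles (insert x F)"
  shows "add_mset x (mset_set (F - Y) + W) \<in> monomials"
proof -
  have "x \<notin> Y" "finite (F - Y)" using assms(1,3) forestsD(1,4)[OF assms(1)] by auto
  then have "insert x F - Y = insert x (F - Y)" by auto
  then have "mset_set (insert x F - Y) = add_mset x (mset_set (F - Y))"
    using \<open>finite (F - Y)\<close> assms(3) by simp
  then have "add_mset x (mset_set (F - Y) + W) = mset_set (insert x F - Y) + W" by simp
  then show ?thesis using assms(2,4) unfolding monomials_def by blast
qed

lemma insert_in_forests:
  assumes "F \<in> forests" "x \<in> E" "g x = Upair c d" "\<not> conn g F c d"
  shows "x \<notin> F" and "insert x F \<in> forests"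
proof -
  show x: "x \<notin> F" using conn_edge[of x F g c d] assms(3,4) by blast
  show "insert x F \<in> forests"
    using forest_insert[of x F g c d] assms x by (auto simp: forests_def)
qed

text \<open>An uncovered vertex \<open>c\<close> is a trivial component without marks. Inserting
  \<open>x\<close> joins it to one other component and merges no marked ones, so the monomial could
  be multiplied by \<open>x\<close>.\<close>

lemma facet_covers_vertices:
  assumes m: "mset_set (F - Y) + W \<in> facets monomials" and F: "F \<in> forests"
    and W: "W \<in> singles F \<union> doubles F" and x: "x \<in> E" "g x = Upair c d" "c \<noteq> d"
  shows "\<exists>e\<in>F. c \<in> set_uprod (g e)"
proof (rule ccontr)
  assume iso: "\<not> ?thesis"
  then have nc: "conn g F c z \<Longrightarrow> z = c" for z using conn_isolated[of g F c z] by blast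
  then have "\<not> conn g F c d" using x(3) by blast
  note F' = insert_in_forests[OF F x(1,2) this]
  have "W \<in> singles (insert x F) \<union> doubles (insert x F)"
  proof (rule marks_insert[OF F F'(2) W])
    fix e f
    assume ef: "e \<in># W" "f \<in># W" "ecomp (insert x F) e = ecomp (insert x F) f"
    then have eF: "e \<in> F" "f \<in> F" using marks_subset[OF F W] by auto
    obtain p r where pr: "p \<in> set_uprod (g e)" "r \<in> set_uprod (g f)" using ex_end by metis
    have "conn g (insert x F) p r"
      using ecomp_eq_iff[OF F'(2) _ pr(1) _ pr(2)] ef(3) eF by simp
    moreover have "\<not> conn g F p c" "\<not> conn g F c r"
      using nc[of p] nc[of r] conn_sym[of g F p c] iso pr eF by auto
    ultimately have "conn g F p r" using conn_insert[of g x c d F p r, OF x(2)] by blast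
    then show "ecomp F e = ecomp F f" using ecomp_eq_iff[OF F eF(1) pr(1) eF(2) pr(2)] by simp
  qed
  then show False using facetD[OF m] monomials_insert_edge[OF F F'(2,1)] by blast
qed

text \<open>An edge \<open>h\<close> of an unmarked component could be added to the marks.\<close>

lemma facet_covers_components:
  assumes m: "mset_set (F - Y) + W \<in> facets monomials" and F: "F \<in> forests"
    and W: "W \<in> singles F \<union> doubles F"
  shows "ecomp F ` set_mset W = ecomp F ` F"
proof (rule ccontr)
  assume "\<not> ?thesis"
  then obtain h where h: "h \<in> F" "ecomp F h \<notin> ecomp F ` set_mset W"
    using marks_subset[OF F W] by blast
  have finK: "K \<subseteq> F \<Longrightarrow> finite K" for K using forestsD(4)[OF F] finite_subset by blast
  have "add_mset h W \<in> singles F \<union> doubles F"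
  proof (cases "W \<in> singles F")
    case True
    then obtain K where K: "K \<subseteq> F" "inj_on (ecomp F) K" "W = mset_set K"
      by (auto simp: in_singles_iff)
    have hK: "ecomp F h \<notin> ecomp F ` K" using h K finK by simp
    then have "h \<notin> K" by blast
    then have "inj_on (ecomp F) (insert h K)" "add_mset h W = mset_set (insert h K)"
      using hK K finK by simp_all
    then show ?thesis using singlesI[of "insert h K" F] K(1) h(1) by simp
  next
    case False
    then obtain a b e f K where *: "a \<in> V" "b \<in> V" "col a" "\<not> col b" "leaves g F e a b"
      "leaves g F f b a" "K \<subseteq> F" "inj_on (ecomp F) K" "ecomp F e \<notin> ecomp F ` K"
      "W = add_mset e (add_mset f (mset_set K))"
      using W in_doubles_iff[OF F] by blast
    have hK: "ecomp F h \<notin> ecomp F ` K" "ecomp F h \<noteq> ecomp F e" using h *(7,10) finK by auto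
    then have "h \<notin> K" by blast
    then have "inj_on (ecomp F) (insert h K)" "ecomp F e \<notin> ecomp F ` (insert h K)"
      "mset_set (insert h K) = add_mset h (mset_set K)"
      using hK *(7,8,9) finK by auto
    then have "add_mset e (add_mset f (mset_set (insert h K))) \<in> doubles F"
      by (intro doublesI[OF F *(5,6,1,2)]) (use *(3,4,7) h(1) in auto)
    moreover have "add_mset e (add_mset f (mset_set (insert h K))) = add_mset h W"
      using *(10) \<open>mset_set (insert h K) = _\<close> by (simp add: add_mset_commute)
    ultimately show ?thesis by simp
  qed
  then have "mset_set (F - Y) + add_mset h W \<in> monomials" using F unfolding monomials_def by blast
  then show False using facetD[OF m, of h] by simp
qed

text \<open>The component carries a mark \<open>e\<close>. Every vertex \<open>z\<close> of it is
  reached from one end of \<open>e\<close> by a path that starts with \<open>e\<close>, and by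
  maximality the two ends of such a path agree in colour. Applied to \<open>e\<close> itself this
  makes its ends agree, so all vertices share their colour.\<close>

lemma facet_single_monochromatic:
  assumes m: "mset_set (F - Y) + W \<in> facets monomials" and F: "F \<in> forests"
    and W: "W \<in> singles F" and ab: "a \<in> V" "conn g F a b"
  shows "col a = col b"
proof (cases "a = b")
  case False
  note f = forestsD(3)[OF F] and fin = forestsD(4)[OF F]
  obtain K where K: "K \<subseteq> F" "inj_on (ecomp F) K" "W = mset_set K"
    using W by (auto simp: in_singles_iff)
  have finK: "finite K" using K(1) fin by (rule finite_subset)
  obtain h where h: "leaves g F h a b" using ex_leaves[OF fin f ab(2) False] by blast
  then have "h \<in> F" by (simp add: leaves_def)
  then have "ecomp F h \<in> ecomp F ` K"
    using facet_covers_components[OF m F] W K(3) finK by simp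
  then obtain e where e: "e \<in> K" "ecomp F e = ecomp F h" by (metis imageE)
  then have eF: "e \<in> F" using K(1) by blast
  have "inj_on (ecomp F) (insert e (K - {e}))" using K(2) e(1) by (simp add: insert_absorb)
  then have Ke: "ecomp F e \<notin> ecomp F ` (K - {e})" "inj_on (ecomp F) (K - {e})"
    by (simp_all only: inj_on_insert Diff_idemp simp_thms)
  \<comment> \<open>If the colours differed, the last edge \<open>k\<close> of the path could join
    \<open>e\<close> as the second mark of an admissible pair, and the monomial could be multiplied
    by \<open>k\<close>.\<close>
  have same: "col u = col z" if l: "leaves g F e u z" for u z
  proof (rule ccontr)
    assume ne: "col u \<noteq> col z"
    then have "u \<noteq> z" by blast
    have "conn g F z u" using l conn_sym by (auto simp: leaves_def)
    then obtain k where k: "leaves g F k z u" using ex_leaves[OF fin f] \<open>u \<noteq> z\<close> by metis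
    have "add_mset e (add_mset k (mset_set (K - {e}))) \<in> doubles F"
    proof (rule doublesI[OF F l k _ _ ne _ Ke(2,1)])
      show "u \<in> V" "z \<in> V" using leaves_in_V[OF F l] by auto
      show "K - {e} \<subseteq> F" using K(1) by blast
    qed
    moreover have "add_mset e (add_mset k (mset_set (K - {e}))) = add_mset k W"
      using K(3) mset_set.remove[OF finK e(1)] by (simp add: add_mset_commute)
    ultimately have "add_mset k W \<in> doubles F" by simp
    then have "mset_set (F - Y) + add_mset k W \<in> monomials" using F unfolding monomials_def by blast
    then show False using facetD[OF m, of k] by simp
  qed
  obtain p q where pq: "g e = Upair p q" by (rule obtain_ends)
  have pa: "conn g F p a"
    using ecomp_eq_iff[OF F eF _ \<open>h \<in> F\<close>, of p a] e(2) h pq by (auto simp: leaves_def)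
  have cpq: "conn g F p q" "conn g F q p"
    using conn_edge[of e F g p q] eF pq conn_commute[of g F q p] by simp_all
  have npq: "\<not> conn g (F - {e}) p q" "\<not> conn g (F - {e}) q p"
    using forestD[of g F e p q, OF f eF pq] conn_commute[of g "F - {e}" q p] by simp_all
  have "leaves g F e p q" using eF pq cpq npq by (auto simp: leaves_def)
  then have "col p = col q" by (rule same)
  moreover have "col z = col p \<or> col z = col q" if z: "conn g F p z" for z
  proof -
    obtain u where u: "leaves g F e u z" using ex_leaves_at[OF f eF _ z] pq by auto
    then have "u = p \<or> u = q" using pq by (auto simp: leaves_def)
    then show ?thesis using same[OF u] by auto
  qed
  ultimately show ?thesis using pa ab(2) conn_trans by metis
qed simp

text \<open>Without a pair all components are monochromatic, so \<open>x\<close> joins two different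
  components, each with one mark. These marks \<open>e\<close> and \<open>h\<close> start paths from
  \<open>p\<close> to \<open>c\<close> and from \<open>s\<close> to \<open>d\<close>. With
  \<open>x\<close> the two paths form one from \<open>p\<close> to \<open>s\<close>, whose ends
  differ in colour and whose end edges are \<open>e\<close> and \<open>h\<close>. So the monomial
  could be multiplied by \<open>x\<close>.\<close>

lemma facet_double:
  assumes m: "mset_set (F - Y) + W \<in> facets monomials" and F: "F \<in> forests"
    and W: "W \<in> singles F \<union> doubles F"
    and x: "x \<in> E" "g x = Upair c d" "col c" "\<not> col d"
  shows "W \<in> doubles F"
proof (rule ccontr)
  assume "W \<notin> doubles F"
  then have WS: "W \<in> singles F" using W by blast
  note mono = facet_single_monochromatic[OF m F WS]
  note f = forestsD(3)[OF F] and fin = forestsD(4)[OF F]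
  obtain K where K: "K \<subseteq> F" "inj_on (ecomp F) K" "W = mset_set K"
    using WS by (auto simp: in_singles_iff)
  have finK: "finite K" using K(1) fin by (rule finite_subset)
  have cd: "c \<in> V" "d \<in> V" "c \<noteq> d" using ends_V[OF x(1)] x by auto
  have ncd: "\<not> conn g F c d" using mono[OF cd(1)] x(3,4) by blast
  note F' = insert_in_forests[OF F x(1,2) ncd]
  have dc: "g x = Upair d c" using x(2) by (simp add: Upair_commute)
  \<comment> \<open>A covered vertex \<open>y\<close> lies in a marked component, and the path to
    \<open>y\<close> from one end of the mark starts with the mark.\<close>
  have mark: "\<exists>e\<in>K. \<exists>p. leaves g F e p y" if yF: "\<exists>k\<in>F. y \<in> set_uprod (g k)" for y
  proof -
    obtain k where k: "k \<in> F" "y \<in> set_uprod (g k)" using yF by blast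
    then have "ecomp F k \<in> ecomp F ` K"
      using facet_covers_components[OF m F W] K(3) finK by simp
    then obtain e where e: "e \<in> K" "ecomp F e = ecomp F k" by (metis imageE)
    obtain p where p: "p \<in> set_uprod (g e)" using ex_end by metis
    have "conn g F p y" using ecomp_eq_iff[OF F _ p k] e K(1) by blast
    then show ?thesis using ex_leaves_at[OF f _ p] e(1) K(1) by blast
  qed
  obtain e p where e: "e \<in> K" "leaves g F e p c"
    using mark[OF facet_covers_vertices[OF m F W x(1,2) cd(3)]] by blast
  obtain h s where h: "h \<in> K" "leaves g F h s d"
    using mark[OF facet_covers_vertices[OF m F W x(1) dc]] cd(3) by blast
  have pc: "conn g F p c" and sd: "conn g F s d" using e(2) h(2) by (auto simp: leaves_def)
  have V: "p \<in> V" "s \<in> V" using leaves_in_V[OF F] e(2) h(2) by blast+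
  have cols: "col p" "\<not> col s" using mono[OF V(1) pc] mono[OF V(2) sd] x(3,4) by auto
  \<comment> \<open>Past \<open>c\<close> the path continues along \<open>x\<close> into the
    component of \<open>d\<close>, which does not contain \<open>e\<close>; hence \<open>e\<close>
    stays indispensable. The general form serves both directions of the joined path.\<close>
  have extend: "leaves g (insert x F) e p s"
    if l: "leaves g F e p c" and sd: "conn g F s d" and gx: "g x = Upair c d"
      and n: "\<not> conn g F c d" for e p s c d
  proof -
    have l': "leaves g (insert x F) e p c"
      using leaves_mono[OF l _ forestsD(3)[OF F'(2)]] by blast
    obtain q where q: "e \<in> F" "g e = Upair p q" "conn g F p c"
      using l by (rule leavesE)
    have "conn g (F - {e}) s d"
    proof (rule ccontr)
      assume "\<not> conn g (F - {e}) s d"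
      then have "conn g (F - {e}) s p \<or> conn g (F - {e}) p d"
        using conn_removed_edge[of g F s d e p q, OF sd _ q(2)] by blast
      then have "conn g F s p \<or> conn g F p d" using conn_mono[of "F - {e}" F g] by blast
      then show False using n sd q(3) conn_sym conn_trans by metis
    qed
    moreover have xe: "x \<noteq> e" using q(1) F'(1) by blast
    ultimately have "conn g (insert x F - {e}) s d"
      using conn_mono[of "F - {e}" "insert x F - {e}" g s d] by blast
    moreover have "conn g (insert x F - {e}) c d"
      using conn_edge[of x "insert x F - {e}" g c d] gx xe by simp
    ultimately have cs: "conn g (insert x F - {e}) c s" using conn_sym conn_trans by metis
    then have "conn g (insert x F) c s" using conn_mono[of "insert x F - {e}" "insert x F" g c s] by blast
    then show ?thesis
      using l' cs conn_trans[of g _ p c s] conn_trans[of g _ p s c] conn_sym[of g _ c s]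
      by (auto simp: leaves_def)
  qed
  have le: "leaves g (insert x F) e p s" by (rule extend[OF e(2) sd x(2) ncd])
  have "\<not> conn g F d c" using ncd conn_sym[of g F d c] by blast
  then have lh: "leaves g (insert x F) h s p" by (rule extend[OF h(2) pc dc])
  have eF: "e \<in> F" "h \<in> F" using e h K(1) by auto
  have ends: "p \<in> set_uprod (g e)" "s \<in> set_uprod (g h)" using e(2) h(2) by (auto simp: leaves_def)
  have "\<not> conn g F p s" using pc sd ncd conn_sym conn_trans by metis
  then have "e \<noteq> h" using ends eF conn_ends[of e F p g s] by blast
  define K' where "K' = K - {e, h}"
  have K': "K' \<subseteq> F" "inj_on (ecomp F) K'" using K(1,2) by (auto simp: K'_def inj_on_diff)
  \<comment> \<open>The remaining marks lie in components that \<open>x\<close> does not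
    touch.\<close>
  have apart: "conn g (insert x F) y r \<longleftrightarrow> conn g F y r"
    if k: "k \<in> K'" "r \<in> set_uprod (g k)" for k r y
  proof -
    have kK: "k \<in> K" "k \<noteq> e" "k \<noteq> h" using k(1) by (auto simp: K'_def)
    then have "ecomp F k \<noteq> ecomp F e" "ecomp F k \<noteq> ecomp F h"
      using K(2) e(1) h(1) by (auto dest: inj_onD)
    then have "\<not> conn g F r p" "\<not> conn g F r s"
      using ecomp_eq_iff[OF F _ k(2)] ends eF kK(1) K(1) by blast+
    then have "\<not> conn g F c r" "\<not> conn g F d r" using pc sd conn_sym conn_trans by metis+
    then show ?thesis using conn_insert[of g x c d F y r, OF x(2)] by blast
  qed
  have same: "ecomp (insert x F) k = ecomp (insert x F) l \<longleftrightarrow> ecomp F k = ecomp F l"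
    if kl: "k \<in> F" "l \<in> K'" for k l
  proof -
    obtain y r where yr: "y \<in> set_uprod (g k)" "r \<in> set_uprod (g l)" using ex_end by metis
    have "l \<in> F" using kl(2) K'(1) by blast
    then show ?thesis
      using ecomp_eq_iff[OF F kl(1) yr(1) _ yr(2)] ecomp_eq_iff[OF F'(2) _ yr(1) _ yr(2)]
        apart[OF kl(2) yr(2)] kl(1) by simp
  qed
  have "inj_on (ecomp (insert x F)) K'"
    by (rule inj_on_coarsen[OF K'(2)]) (use same K'(1) in blast)
  moreover have "ecomp (insert x F) e \<notin> ecomp (insert x F) ` K'"
  proof
    assume "ecomp (insert x F) e \<in> ecomp (insert x F) ` K'"
    then obtain l where l: "l \<in> K'" "ecomp F e = ecomp F l" using same eF by blast
    then have "l \<in> K" "l \<noteq> e" by (auto simp: K'_def)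
    then show False using l(2) K(2) e(1) by (auto dest: inj_onD)
  qed
  ultimately have "add_mset e (add_mset h (mset_set K')) \<in> doubles (insert x F)"
    by (intro doublesI[OF F'(2) le lh V]) (use cols K'(1) in auto)
  moreover have "add_mset e (add_mset h (mset_set K')) = W"
  proof -
    have "K = insert e (insert h K')" using e(1) h(1) by (auto simp: K'_def)
    moreover have "finite K'" "e \<notin> insert h K'" "h \<notin> K'"
      using finK \<open>e \<noteq> h\<close> by (auto simp: K'_def)
    ultimately show ?thesis using K(3) by simp
  qed
  ultimately show False
    using facetD[OF m] monomials_insert_edge[OF F F'(2,1)] by blast
qed

text \<open>The number of nontrivial components cancels: together with \<open>card F\<close> it
  gives \<open>card V - card isolated\<close>, and it is also the number of marks, up to the extra
  mark of a pair. Which of the two cases occurs depends on the graph only.\<close>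

lemma size_facet:
  assumes m: "m \<in> facets monomials"
  shows "size m = card V - card Y - card isolated +
    (if \<exists>e\<in>E. \<exists>x y. g e = Upair x y \<and> col x \<and> \<not> col y then 1 else 0)"
proof -
  have "m \<in> monomials" using m by (simp add: facets_def)
  then obtain F W where F: "F \<in> forests" and W: "W \<in> singles F \<union> doubles F"
    and mFW: "m = mset_set (F - Y) + W"
    by (auto simp: monomials_def)
  note m' = m[unfolded mFW]
  have "{x \<in> V. \<forall>e\<in>F. x \<notin> set_uprod (g e)} = isolated"
  proof (intro equalityI subsetI)
    fix c
    assume c: "c \<in> {x \<in> V. \<forall>e\<in>F. x \<notin> set_uprod (g e)}"
    have "g e = Upair c c" if e: "e \<in> E" "c \<in> set_uprod (g e)" for e
    proof -
      obtain d where d: "g e = Upair c d" using mem_ends[OF e(2)] by blast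
      then show ?thesis using facet_covers_vertices[OF m' F W e(1) d] c by blast
    qed
    then show "c \<in> isolated" using c by (auto simp: isolated_def)
  next
    fix c
    assume "c \<in> isolated"
    then show "c \<in> {x \<in> V. \<forall>e\<in>F. x \<notin> set_uprod (g e)}"
      using no_loops[OF F] forestsD(2)[OF F] by (auto simp: isolated_def)
  qed
  then have "card F + (card (ecomp F ` F) + card isolated) = card V"
    using card_nontrivial_components[OF F] card_forest_components[OF F] by simp
  moreover have "size W = card (ecomp F ` F) + (if W \<in> doubles F then 1 else 0)"
    by (rule size_facet_marks[OF F W facet_covers_components[OF m' F W]])
  moreover have "W \<in> doubles F \<longleftrightarrow> (\<exists>e\<in>E. \<exists>x y. g e = Upair x y \<and> col x \<and> \<not> col y)"
  proof
    assume "W \<in> doubles F"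
    then obtain a b e where "col a" "\<not> col b" "leaves g F e a b" using in_doubles_iff[OF F] by blast
    then show "\<exists>e\<in>E. \<exists>x y. g e = Upair x y \<and> col x \<and> \<not> col y"
      using ex_bichromatic_edge[of F a b] forestsD(2)[OF F] by (auto simp: leaves_def)
  next
    assume "\<exists>e\<in>E. \<exists>x y. g e = Upair x y \<and> col x \<and> \<not> col y"
    then show "W \<in> doubles F" using facet_double[OF m' F W] by blast
  qed
  moreover have "card (F - Y) = card F - card Y" "card Y \<le> card F"
    using forestsD(1,4)[OF F] by (auto intro: card_Diff_subset card_mono finite_subset)
  ultimately show ?thesis using mFW by auto
qed

lemma pure_monomials: "pure_multicomplex monomials"
  unfolding pure_multicomplex_def using size_facet by simp

end

section \<open>Independent sets of a biconing\<close>

lemma conn_image: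
  assumes "\<And>e. e \<in> F \<Longrightarrow> g' (k e) = map_uprod r (g e)" and "conn g F v w"
  shows "conn g' (k ` F) (r v) (r w)"
  using assms(2)
proof (induction rule: conn_induct)
  case (step y z e)
  have "conn g' (k ` F) (r y) (r z)"
    using conn_edge[of "k e" "k ` F" g' "r y" "r z"] assms(1)[OF step.hyps(2)] step.hyps by simp
  then show ?case using step.IH conn_trans by metis
qed simp

text \<open>Only \<open>conn\<close> is asked of the image of an edge, since \<open>p\<close> may
  collapse it, as happens to the edge between the copies of a split vertex.\<close>

lemma conn_project:
  assumes "\<And>e x y. e \<in> F' \<Longrightarrow> g' e = Upair x y \<Longrightarrow> conn g F (p x) (p y)" and "conn g' F' x y"
  shows "conn g F (p x) (p y)"
  using assms(2)
proof (induction rule: conn_induct)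
  case (step y z e)
  then show ?case using assms(1)[of e y z] conn_trans by metis
qed simp

lemma map_uprod_eq_UpairE:
  assumes "map_uprod r u = Upair x y"
  obtains v w where "u = Upair v w" "x = r v" "y = r w"
  using assms by (cases u) auto

text \<open>The end of a cone edge other than its apex. \<open>MidEdge\<close> is counted as an edge
  at \<open>ZeroBar\<close> with foot \<open>Zero\<close>; the value at an \<open>OrigEdge\<close>
  is a dummy.\<close>

fun foot :: "('v, 'e) bicone_edge \<Rightarrow> 'v bicone_vertex" where
  "foot (ZeroEdge a) = Orig a"
| "foot (ZeroBarEdge b) = Orig b"
| "foot _ = Zero"

fun base :: "'v bicone_vertex \<Rightarrow> 'v" where
  "base (Orig v) = v"
| "base _ = undefined"

text \<open>\<open>K\<close> records the feet of the edges at \<open>Zero\<close> by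
  \<open>Inl\<close> and at \<open>ZeroBar\<close> by \<open>Inr\<close>. The bracketing follows the
  two stars, with \<open>MidEdge\<close> in the star of \<open>ZeroBar\<close>.\<close>

definition bicone_edges :: "'e set \<Rightarrow> ('v + 'v) set \<Rightarrow> bool \<Rightarrow> ('v, 'e) bicone_edge set" where
  "bicone_edges F K mid = OrigEdge ` F \<union> ZeroEdge ` (Inl -` K) \<union>
    (ZeroBarEdge ` (Inr -` K) \<union> (if mid then {MidEdge} else {}))"

lemma conn_OrigEdge:
  "conn (bicone_ends g) (OrigEdge ` F) (Orig v) (Orig w) \<longleftrightarrow> conn g F v w"
proof
  assume c: "conn (bicone_ends g) (OrigEdge ` F) (Orig v) (Orig w)"
  have "conn g F (base (Orig v)) (base (Orig w))"
    by (rule conn_project[OF _ c]) (auto elim!: map_uprod_eq_UpairE intro!: conn_edge[of _ F g])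
  then show "conn g F v w" by simp
next
  assume "conn g F v w"
  then show "conn (bicone_ends g) (OrigEdge ` F) (Orig v) (Orig w)"
    by (intro conn_image[of F "bicone_ends g" OrigEdge Orig g]) auto
qed

lemma conn_OrigEdge_apex:
  assumes "x \<in> {Zero, ZeroBar}"
  shows "conn (bicone_ends g) (OrigEdge ` F) x y \<longleftrightarrow> y = x"
    and "conn (bicone_ends g) (OrigEdge ` F) y x \<longleftrightarrow> y = x"
proof -
  show "conn (bicone_ends g) (OrigEdge ` F) x y \<longleftrightarrow> y = x"
  proof -
    have "x \<notin> set_uprod (bicone_ends g e)" if "e \<in> OrigEdge ` F" for e
      using that assms by (auto simp: uprod.set_map)
    then show ?thesis using conn_isolated[of "bicone_ends g" "OrigEdge ` F" x y] by auto
  qed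
  then show "conn (bicone_ends g) (OrigEdge ` F) y x \<longleftrightarrow> y = x"
    using conn_commute by metis
qed

lemma forest_OrigEdge:
  fixes g :: "'e \<Rightarrow> 'v uprod"
  shows "forest (bicone_ends g) (OrigEdge ` F) \<longleftrightarrow> forest g F"
proof -
  have "OrigEdge ` F - {OrigEdge e :: ('v, 'e) bicone_edge} = OrigEdge ` (F - {e})" for e by auto
  then have "forest (bicone_ends g) (OrigEdge ` F) \<longleftrightarrow>
    (\<forall>e\<in>F. \<forall>x y. map_uprod Orig (g e) = Upair x y \<longrightarrow>
      \<not> conn (bicone_ends g) (OrigEdge ` (F - {e})) x y)"
    by (simp add: forest_def)
  also have "\<dots> \<longleftrightarrow> forest g F"
    unfolding forest_def
  proof (intro ball_cong refl iffI allI impI)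
    fix e x y
    assume "\<forall>x y. map_uprod Orig (g e) = Upair x y \<longrightarrow>
      \<not> conn (bicone_ends g) (OrigEdge ` (F - {e})) x y" "g e = Upair x y"
    then show "\<not> conn g (F - {e}) x y" using conn_OrigEdge by fastforce
  next
    fix e x y
    assume "\<forall>x y. g e = Upair x y \<longrightarrow> \<not> conn g (F - {e}) x y" "map_uprod Orig (g e) = Upair x y"
    then show "\<not> conn (bicone_ends g) (OrigEdge ` (F - {e})) x y"
      by (auto simp: conn_OrigEdge elim!: map_uprod_eq_UpairE)
  qed
  finally show ?thesis .
qed

text \<open>Two uses of \<open>forest_star\<close>, first at \<open>Zero\<close> and then at
  \<open>ZeroBar\<close>. After the first, all vertices whose components have an edge to
  \<open>Zero\<close> are connected. So at most one edge at \<open>ZeroBar\<close> may end in such a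
  component, and none if \<open>MidEdge\<close> is present, whose foot is \<open>Zero\<close>
  itself.\<close>

lemma forest_bicone_edges:
  fixes g :: "'e \<Rightarrow> 'v uprod"
  assumes fin: "finite K"
  shows "forest (bicone_ends g) (bicone_edges F K mid) \<longleftrightarrow> forest g F \<and>
    (\<forall>a a'. Inl a \<in> K \<longrightarrow> Inl a' \<in> K \<longrightarrow> a \<noteq> a' \<longrightarrow> \<not> conn g F a a') \<and>
    (\<forall>b b'. Inr b \<in> K \<longrightarrow> Inr b' \<in> K \<longrightarrow> b \<noteq> b' \<longrightarrow> \<not> conn g F b b' \<and>
      \<not> ((\<exists>a. Inl a \<in> K \<and> conn g F a b) \<and> (\<exists>a. Inl a \<in> K \<and> conn g F a b'))) \<and>
    (mid \<longrightarrow> \<not> (\<exists>a b. Inl a \<in> K \<and> Inr b \<in> K \<and> conn g F a b))"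
proof -
  let ?g = "bicone_ends g"
  let ?J = "OrigEdge ` F :: ('v, 'e) bicone_edge set"
  let ?S = "ZeroEdge ` (Inl -` K) :: ('v, 'e) bicone_edge set"
  let ?S' = "ZeroBarEdge ` (Inr -` K) \<union> (if mid then {MidEdge} else {}) :: ('v, 'e) bicone_edge set"
  have fS: "finite ?S" "finite ?S'" by (simp_all add: finite_vimageI fin)
  have ends: "s \<in> ?S \<Longrightarrow> ?g s = Upair Zero (foot s)" "s \<in> ?S' \<Longrightarrow> ?g s = Upair ZeroBar (foot s)" for s
    by (auto split: if_splits)
  have disj: "?S \<inter> ?J = {}" "?S' \<inter> (?J \<union> ?S) = {}" by auto
  note star = forest_star[of ?S ?g Zero foot ?J, OF fS(1) ends(1) disj(1)]
  have star1: "forest ?g (?J \<union> ?S) \<longleftrightarrow> forest ?g ?J \<and> (\<forall>s\<in>?S. \<not> conn ?g ?J Zero (foot s)) \<and>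
      (\<forall>s\<in>?S. \<forall>s'\<in>?S. s \<noteq> s' \<longrightarrow> \<not> conn ?g ?J (foot s) (foot s'))"
    by (rule conjunct1[OF star])
  have conn1: "conn ?g (?J \<union> ?S) x y \<longleftrightarrow> conn ?g ?J x y \<or>
      (conn ?g ?J Zero x \<or> (\<exists>s\<in>?S. conn ?g ?J (foot s) x)) \<and>
      (conn ?g ?J Zero y \<or> (\<exists>s\<in>?S. conn ?g ?J (foot s) y))" for x y
    by (rule conjunct2[OF star, THEN spec, THEN spec])
  have star2: "forest ?g (?J \<union> ?S \<union> ?S') \<longleftrightarrow> forest ?g (?J \<union> ?S) \<and>
      (\<forall>s\<in>?S'. \<not> conn ?g (?J \<union> ?S) ZeroBar (foot s)) \<and>
      (\<forall>s\<in>?S'. \<forall>s'\<in>?S'. s \<noteq> s' \<longrightarrow> \<not> conn ?g (?J \<union> ?S) (foot s) (foot s'))"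
    by (rule conjunct1[OF forest_star[of ?S' ?g ZeroBar foot "?J \<union> ?S", OF fS(2) ends(2) disj(2)]])
  have base: "forest ?g (?J \<union> ?S) \<longleftrightarrow> forest g F \<and>
      (\<forall>a a'. Inl a \<in> K \<longrightarrow> Inl a' \<in> K \<longrightarrow> a \<noteq> a' \<longrightarrow> \<not> conn g F a a')"
    unfolding star1 by (auto simp: forest_OrigEdge conn_OrigEdge conn_OrigEdge_apex)
  \<comment> \<open>After the first star \<open>ZeroBar\<close> is still isolated, and
    \<open>Zero\<close> reaches the components that have an edge to it.\<close>
  have apex: "\<not> conn ?g (?J \<union> ?S) ZeroBar (Orig b)" "\<not> conn ?g (?J \<union> ?S) ZeroBar Zero"
    "conn ?g (?J \<union> ?S) Zero (Orig b) \<longleftrightarrow> (\<exists>a. Inl a \<in> K \<and> conn g F a b)"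
    "conn ?g (?J \<union> ?S) (Orig b) Zero \<longleftrightarrow> (\<exists>a. Inl a \<in> K \<and> conn g F a b)"
    "conn ?g (?J \<union> ?S) (Orig b) (Orig b') \<longleftrightarrow> conn g F b b' \<or>
      (\<exists>a. Inl a \<in> K \<and> conn g F a b) \<and> (\<exists>a. Inl a \<in> K \<and> conn g F a b')" for b b'
    unfolding conn1 by (auto simp: conn_OrigEdge conn_OrigEdge_apex)
  have eq: "bicone_edges F K mid = ?J \<union> ?S \<union> ?S'" by (simp add: bicone_edges_def)
  define hit where "hit b \<longleftrightarrow> (\<exists>a. Inl a \<in> K \<and> conn g F a b)" for b
  have cross: "(\<exists>a b. Inl a \<in> K \<and> Inr b \<in> K \<and> conn g F a b) \<longleftrightarrow> (\<exists>b. Inr b \<in> K \<and> hit b)"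
    by (auto simp: hit_def)
  have ball: "(\<forall>s\<in>?S'. Q s) \<longleftrightarrow> (\<forall>b. Inr b \<in> K \<longrightarrow> Q (ZeroBarEdge b)) \<and> (mid \<longrightarrow> Q MidEdge)" for Q
    by auto
  have "forest ?g (?J \<union> ?S \<union> ?S') \<longleftrightarrow> forest ?g (?J \<union> ?S) \<and>
      (\<forall>b b'. Inr b \<in> K \<longrightarrow> Inr b' \<in> K \<longrightarrow> b \<noteq> b' \<longrightarrow> \<not> conn g F b b' \<and> \<not> (hit b \<and> hit b')) \<and>
      (mid \<longrightarrow> \<not> (\<exists>b. Inr b \<in> K \<and> hit b))"
    unfolding star2 ball foot.simps apex(3-) hit_def[symmetric]
    by (cases mid)
      (simp_all only: apex(1,2) simp_thms bicone_edge.distinct bicone_edge.inject, blast+)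
  then show ?thesis
    unfolding eq base cross hit_def[symmetric] by blast
qed

section \<open>Splitting the vertices that belong to both cones\<close>

locale biconed_graph =
  fixes G :: "('v, 'e) multigraph" and A B :: "'v set"
  assumes finG: "finite_graph G" and AV: "A \<subseteq> verts G" and BV: "B \<subseteq> verts G"
    and AB: "A \<union> B = verts G"
begin

text \<open>Every vertex of \<open>A \<inter> B\<close> is split into an \<open>A\<close>-copy \<open>Inl v\<close>, which keeps the edges of \<open>G\<close>, and a pendant
  \<open>B\<close>-copy \<open>Inr v\<close>. Colouring by the side makes a cone edge the same thing as a vertex of the split
  graph.\<close>

definition lift :: "'v \<Rightarrow> 'v + 'v" where
  "lift v = (if v \<in> A then Inl v else Inr v)"

definition drop_side :: "'v + 'v \<Rightarrow> 'v" where
  "drop_side = case_sum id id"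

definition split_ends :: "'e + 'v \<Rightarrow> ('v + 'v) uprod" where
  "split_ends = case_sum (\<lambda>e. map_uprod lift (ends G e)) (\<lambda>v. Upair (Inl v) (Inr v))"

definition split_edges :: "'e set \<Rightarrow> ('e + 'v) set" where
  "split_edges F = F <+> (A \<inter> B)"

lemma drop_side_simps [simp]: "drop_side (Inl v) = v" "drop_side (Inr v) = v" "drop_side (lift v) = v"
  by (auto simp: drop_side_def lift_def)

lemma split_ends_simps [simp]:
  "split_ends (Inl e) = map_uprod lift (ends G e)" "split_ends (Inr v) = Upair (Inl v) (Inr v)"
  by (auto simp: split_ends_def)

lemma lift_in: "v \<in> verts G \<Longrightarrow> lift v \<in> A <+> B"
  using AB by (auto simp: lift_def)

lemma conn_split_imp: "conn split_ends (split_edges F) x y \<Longrightarrow> conn (ends G) F (drop_side x) (drop_side y)"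
proof (erule conn_project[rotated])
  fix e x y
  assume "e \<in> split_edges F" "split_ends e = Upair x y"
  then show "conn (ends G) F (drop_side x) (drop_side y)"
  proof (cases e)
    case (Inl e')
    then have "e' \<in> F" "map_uprod lift (ends G e') = Upair x y"
      using \<open>e \<in> split_edges F\<close> \<open>split_ends e = Upair x y\<close> by (auto simp: split_edges_def)
    then show ?thesis by (auto elim!: map_uprod_eq_UpairE intro: conn_edge[of e' F "ends G"])
  next
    case (Inr v)
    then show ?thesis using \<open>split_ends e = Upair x y\<close> by auto
  qed
qed

lemma conn_lift: "conn (ends G) F v w \<Longrightarrow> conn split_ends (Inl ` F) (lift v) (lift w)"
  by (rule conn_image[of F split_ends Inl lift "ends G"]) auto

lemma conn_lift_drop: "x \<in> A <+> B \<Longrightarrow> conn split_ends (split_edges F) x (lift (drop_side x))"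
  using conn_edge[of "Inr (drop_side x)" "split_edges F" split_ends "Inr (drop_side x)" "Inl (drop_side x)"]
  by (cases x) (auto simp: lift_def split_edges_def)

lemma conn_split_iff:
  assumes "x \<in> A <+> B" "y \<in> A <+> B"
  shows "conn split_ends (split_edges F) x y \<longleftrightarrow> conn (ends G) F (drop_side x) (drop_side y)"
proof
  assume "conn (ends G) F (drop_side x) (drop_side y)"
  then have "conn split_ends (split_edges F) (lift (drop_side x)) (lift (drop_side y))"
    using conn_mono[OF _ conn_lift, of F "split_edges F"] by (auto simp: split_edges_def)
  then show "conn split_ends (split_edges F) x y"
    using conn_lift_drop[OF assms(1)] conn_lift_drop[OF assms(2)] conn_sym conn_trans by metis
qed (rule conn_split_imp)

text \<open>Deleting \<open>Inl e\<close> commutes with the splitting, so it is a bridge iff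
  \<open>e\<close> is. An edge \<open>Inr v\<close> is always a bridge, because the copy
  \<open>Inr v\<close> has no other edge.\<close>

lemma forest_split: "forest split_ends (split_edges F) \<longleftrightarrow> forest (ends G) F"
proof
  assume f: "forest split_ends (split_edges F)"
  show "forest (ends G) F"
    unfolding forest_def
  proof (intro ballI allI impI notI)
    fix e x y
    assume e: "e \<in> F" "ends G e = Upair x y" "conn (ends G) (F - {e}) x y"
    have "Inl ` (F - {e}) \<subseteq> split_edges F - {Inl e}" by (auto simp: split_edges_def)
    then have "conn split_ends (split_edges F - {Inl e}) (lift x) (lift y)"
      using conn_lift[OF e(3)] by (rule conn_mono)
    then show False
      using forestD[of split_ends "split_edges F" "Inl e" "lift x" "lift y", OF f] e(1,2)
      by (auto simp: split_edges_def)
  qed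
next
  assume f: "forest (ends G) F"
  show "forest split_ends (split_edges F)"
    unfolding forest_def
  proof (intro ballI allI impI notI)
    fix k x y
    assume k: "k \<in> split_edges F" "split_ends k = Upair x y"
      "conn split_ends (split_edges F - {k}) x y"
    show False
    proof (cases k)
      case (Inl e)
      then have e: "e \<in> F" using k(1) by (auto simp: split_edges_def)
      have "split_edges F - {k} = split_edges (F - {e})" using Inl by (auto simp: split_edges_def)
      then have c: "conn (ends G) (F - {e}) (drop_side x) (drop_side y)"
        using k(3) conn_split_imp by metis
      have "map_uprod lift (ends G e) = Upair x y" using k(2) Inl by simp
      then have "ends G e = Upair (drop_side x) (drop_side y)"
        by (auto elim!: map_uprod_eq_UpairE)
      then show False using forestD[of "ends G" F e, OF f e] c by blast
    next
      case (Inr v)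
      then have v: "v \<in> A" using k(1) by (auto simp: split_edges_def)
      have iso: "Inr v \<notin> set_uprod (split_ends h)" if "h \<in> split_edges F - {k}" for h
        using that v Inr by (cases h) (auto simp: lift_def uprod.set_map split: if_splits)
      have "x = Inl v \<and> y = Inr v \<or> x = Inr v \<and> y = Inl v" using k(2) Inr by auto
      then have "conn split_ends (split_edges F - {k}) (Inr v) (Inl v)" using k(3) conn_sym by metis
      then show False
        using conn_isolated[of split_ends "split_edges F - {k}" "Inr v" "Inl v"] iso by blast
    qed
  qed
qed

lemma finite_AB: "finite A" "finite B" "finite (edges G)"
  using finG AV BV by (auto simp: finite_graph_def intro: finite_subset)

sublocale two_coloured_graph split_ends "A <+> B" "split_edges (edges G)" "Inr ` (A \<inter> B)" isl
proof
  show "finite (A <+> B)" "finite (split_edges (edges G))"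
    using finite_AB by (auto simp: split_edges_def)
  show "Inr ` (A \<inter> B) \<subseteq> split_edges (edges G)" by (auto simp: split_edges_def)
  fix k
  assume "k \<in> split_edges (edges G)"
  then show "set_uprod (split_ends k) \<subseteq> A <+> B"
    using finG lift_in by (cases k) (auto simp: split_edges_def uprod.set_map finite_graph_def)
qed

lemma forests_eq: "forests = split_edges ` {F. F \<subseteq> edges G \<and> forest (ends G) F}"
proof (intro equalityI subsetI)
  fix F'
  assume F': "F' \<in> forests"
  have sub: "Inr ` (A \<inter> B) \<subseteq> F'" "F' \<subseteq> split_edges (edges G)" using F' by (auto simp only: forests_def)
  then have "F' = split_edges (Inl -` F')" unfolding split_edges_def by fast
  moreover have "Inl -` F' \<subseteq> edges G" using sub(2) unfolding split_edges_def by fast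
  moreover have "forest (ends G) (Inl -` F')"
    using F' forest_split[of "Inl -` F'"] calculation(1) by (simp add: forests_def)
  ultimately show "F' \<in> split_edges ` {F. F \<subseteq> edges G \<and> forest (ends G) F}" by blast
next
  fix F'
  assume "F' \<in> split_edges ` {F. F \<subseteq> edges G \<and> forest (ends G) F}"
  then obtain F where F: "F \<subseteq> edges G" "forest (ends G) F" "F' = split_edges F" by blast
  have "Inr ` (A \<inter> B) \<subseteq> F'" "F' \<subseteq> split_edges (edges G)"
    using F(1,3) by (auto simp: split_edges_def)
  then show "F' \<in> forests" using F(2,3) forest_split by (simp only: forests_def mem_Collect_eq)
qed

lemma inj_split_edges: "inj split_edges"
proof (rule injI)
  fix F F'
  assume "split_edges F = split_edges F'"
  then have "Inl -` split_edges F = Inl -` split_edges F'" by simp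
  moreover have "Inl -` split_edges F = F" for F by (auto simp: split_edges_def)
  ultimately show "F = F'" by simp
qed

section \<open>Sets of cone edges as markings\<close>

definition side_pair :: "('v + 'v) \<times> ('v + 'v) \<Rightarrow> ('v + 'v) multiset" where
  "side_pair = (\<lambda>(a, b). {#a, b#})"

abbreviation vcomp :: "('e + 'v) set \<Rightarrow> 'v + 'v \<Rightarrow> ('v + 'v) set" where
  "vcomp F \<equiv> component split_ends (A <+> B) F"

abbreviation cone_doubles :: "('e + 'v) set \<Rightarrow> ('v + 'v) multiset set" where
  "cone_doubles F \<equiv> double_marks (vcomp F) (A <+> B) (pair_component F) side_pair (mixed_pairs F)"

text \<open>The second instance of the count. It has the same classes and the same index set of
  pairs as \<open>marked_pairs_forest\<close>, but a pair is marked by its two vertices instead of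
  the end edges of their path.\<close>

lemma marked_pairs_cone:
  assumes "F \<in> forests"
  shows "marked_pairs (components split_ends (A <+> B) F) (A <+> B) (vcomp F)
    (mixed_pairs F) (pair_component F) side_pair"
proof
  show "finite (components split_ends (A <+> B) F)" using finV by (simp add: components_def)
  show "finite (A <+> B)" by (rule finV)
  show "finite (mixed_pairs F)"
    by (rule finite_subset[of _ "(A <+> B) \<times> (A <+> B)"]) (use finV in \<open>auto simp: mixed_pairs_def\<close>)
  show "vcomp F ` (A <+> B) \<subseteq> components split_ends (A <+> B) F"
    by (simp add: components_def)
  show "pair_component F ` mixed_pairs F \<subseteq> components split_ends (A <+> B) F"
    by (auto simp: pair_component_def mixed_pairs_def components_def)
  show "inj_on side_pair (mixed_pairs F)"
    by (rule inj_onI) (auto simp: side_pair_def mixed_pairs_def add_eq_conv_ex)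
  fix z
  assume z: "z \<in> mixed_pairs F"
  show "size (side_pair z) = 2" by (cases z) (simp add: side_pair_def)
  fix x
  assume "x \<in># side_pair z"
  then show "x \<in> A <+> B \<and> vcomp F x = pair_component F z"
    using z component_conn[of F "fst z" "snd z"]
    by (cases z) (auto simp: side_pair_def mixed_pairs_def pair_component_def)
qed

text \<open>A connected pair of feet from different sides is unique if it exists, and it forces
  \<open>MidEdge\<close> to be absent. The feet then form a double marking; without such a pair they
  form a partial transversal of the components.\<close>

lemma cone_condition_iff:
  assumes F: "F \<subseteq> edges G" and K: "K \<subseteq> A <+> B"
  defines "F' \<equiv> split_edges F"
  shows "(\<forall>a a'. Inl a \<in> K \<longrightarrow> Inl a' \<in> K \<longrightarrow> a \<noteq> a' \<longrightarrow> \<not> conn (ends G) F a a') \<and>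
    (\<forall>b b'. Inr b \<in> K \<longrightarrow> Inr b' \<in> K \<longrightarrow> b \<noteq> b' \<longrightarrow> \<not> conn (ends G) F b b' \<and>
      \<not> ((\<exists>a. Inl a \<in> K \<and> conn (ends G) F a b) \<and> (\<exists>a. Inl a \<in> K \<and> conn (ends G) F a b'))) \<and>
    (mid \<longrightarrow> \<not> (\<exists>a b. Inl a \<in> K \<and> Inr b \<in> K \<and> conn (ends G) F a b)) \<longleftrightarrow>
    K \<in> ptrans (vcomp F') (A <+> B) \<or> \<not> mid \<and> mset_set K \<in> cone_doubles F'"
    (is "?C \<longleftrightarrow> ?R")
proof -
  have finK: "finite K" using K finV by (rule finite_subset)
  define c where "c x y \<longleftrightarrow> conn (ends G) F (drop_side x) (drop_side y)" for x y
  have c_sym: "c x y \<Longrightarrow> c y x" and c_trans: "c x y \<Longrightarrow> c y z \<Longrightarrow> c x z" for x y z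
    unfolding c_def by (rule conn_sym, assumption) (rule conn_trans, assumption+)
  have vc: "vcomp F' x = vcomp F' y \<longleftrightarrow> c x y" if "x \<in> A <+> B" "y \<in> A <+> B" for x y
    using component_eq_iff[of y "A <+> B" split_ends F' x] conn_split_iff[OF that] that
    by (simp add: F'_def c_def)
  have pt: "L \<in> ptrans (vcomp F') (A <+> B) \<longleftrightarrow> (\<forall>x\<in>L. \<forall>y\<in>L. x \<noteq> y \<longrightarrow> \<not> c x y)" if "L \<subseteq> K" for L
  proof -
    have sub: "L \<subseteq> A <+> B" using that K by (rule subset_trans)
    then have "vcomp F' x = vcomp F' y \<longleftrightarrow> c x y" if "x \<in> L" "y \<in> L" for x y
      using vc that by (meson subsetD)
    then have "inj_on (vcomp F') L \<longleftrightarrow> (\<forall>x\<in>L. \<forall>y\<in>L. x \<noteq> y \<longrightarrow> \<not> c x y)"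
      unfolding inj_on_def by metis
    then show ?thesis using sub by (simp add: ptrans_def)
  qed
  have ball: "(\<forall>x\<in>K. P x) \<longleftrightarrow> (\<forall>a. Inl a \<in> K \<longrightarrow> P (Inl a)) \<and> (\<forall>b. Inr b \<in> K \<longrightarrow> P (Inr b))" for P
    unfolding Ball_def by (rule split_sum_all)
  \<comment> \<open>By the second conjunct all connected pairs of different colours share their
    \<open>B\<close>-foot; with the first conjunct this leaves at most one such pair.\<close>
  have C: "?C \<longleftrightarrow> (\<forall>x\<in>K. \<forall>y\<in>K. isl x = isl y \<longrightarrow> x \<noteq> y \<longrightarrow> \<not> c x y) \<and>
    (\<forall>x\<in>K. \<forall>y\<in>K. \<forall>z\<in>K. \<forall>w\<in>K. isl x \<longrightarrow> isl z \<longrightarrow> \<not> isl y \<longrightarrow> \<not> isl w \<longrightarrow> c x y \<longrightarrow> c z w \<longrightarrow> y = w) \<and>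
    (mid \<longrightarrow> (\<forall>x\<in>K. \<forall>y\<in>K. isl x \<longrightarrow> \<not> isl y \<longrightarrow> \<not> c x y))" (is "_ \<longleftrightarrow> ?D")
    unfolding ball c_def by (simp only: drop_side_simps sum.disc sum.inject simp_thms) (safe; metis)
  have D: "mset_set K \<in> cone_doubles F' \<longleftrightarrow> (\<exists>a b L. isl a \<and> \<not> isl b \<and> c a b \<and> a \<notin> L \<and> b \<notin> L \<and>
     K = insert a (insert b L) \<and> (\<forall>x\<in>L. \<forall>y\<in>L. x \<noteq> y \<longrightarrow> \<not> c x y) \<and> (\<forall>x\<in>L. \<not> c x a))"
     (is "_ \<longleftrightarrow> ?E")
  proof
    assume "mset_set K \<in> cone_doubles F'"
    then obtain a b L where L: "(a, b) \<in> mixed_pairs F'"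
      "L \<in> ptrans (vcomp F') {x \<in> A <+> B. vcomp F' x \<noteq> pair_component F' (a, b)}"
      "mset_set K = {#a, b#} + mset_set L"
      by (auto simp: double_marks_def side_pair_def)
    have LV: "L \<subseteq> A <+> B" "inj_on (vcomp F') L" "\<forall>x\<in>L. vcomp F' x \<noteq> vcomp F' a"
      using L(2) by (auto simp: ptrans_def pair_component_def)
    have finL: "finite L" using LV(1) finV by (rule finite_subset)
    have "set_mset (mset_set K) = insert a (insert b (set_mset (mset_set L)))" unfolding L(3) by simp
    then have KL: "K = insert a (insert b L)" using finK finL by simp
    have ab: "a \<in> A <+> B" "b \<in> A <+> B" "isl a" "\<not> isl b"
      and "conn split_ends F' a b" using L(1) by (auto simp only: mixed_pairs_def mem_Collect_eq prod.case)
    then have cab: "c a b" using conn_split_iff[OF ab(1,2)] by (simp add: c_def F'_def)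
    have La: "\<forall>x\<in>L. \<not> c x a" using LV(1,3) vc[OF _ ab(1)] by blast
    then have "a \<notin> L" "b \<notin> L" using cab c_sym by (auto simp: c_def)
    moreover have "L \<in> ptrans (vcomp F') (A <+> B)" using LV by (simp add: ptrans_def)
    ultimately show ?E using pt[of L] KL La ab cab by blast
  next
    assume ?E
    then obtain a b L where E: "isl a" "\<not> isl b" "c a b" "a \<notin> L" "b \<notin> L" "K = insert a (insert b L)"
      "\<forall>x\<in>L. \<forall>y\<in>L. x \<noteq> y \<longrightarrow> \<not> c x y" "\<forall>x\<in>L. \<not> c x a"
      by blast
    have ab: "a \<in> A <+> B" "b \<in> A <+> B" "L \<subseteq> K" using K E(6) by auto
    have finL: "finite L" using ab(3) finK by (rule finite_subset)
    have "(a, b) \<in> mixed_pairs F'"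
      using E(1-3) ab conn_split_iff[OF ab(1,2)] by (simp add: mixed_pairs_def c_def F'_def)
    moreover have "\<forall>x\<in>L. vcomp F' x \<noteq> vcomp F' a"
      using E(8) vc[OF _ ab(1)] ab(3) K by (meson subsetD)
    then have "L \<in> ptrans (vcomp F') {x \<in> A <+> B. vcomp F' x \<noteq> pair_component F' (a, b)}"
      using pt[OF ab(3)] E(7) by (auto simp: ptrans_def pair_component_def)
    moreover have "a \<noteq> b" using E(1,2) by blast
    then have "mset_set K = side_pair (a, b) + mset_set L"
      using E(4-6) finL by (simp add: side_pair_def)
    ultimately show "mset_set K \<in> cone_doubles F'"
      unfolding double_marks_def by (intro image_eqI[of _ _ "((a, b), L)"]) auto
  qed
  have "?D \<longleftrightarrow> (\<forall>x\<in>K. \<forall>y\<in>K. x \<noteq> y \<longrightarrow> \<not> c x y) \<or> \<not> mid \<and> ?E"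
  proof
    assume D: ?D
    show "(\<forall>x\<in>K. \<forall>y\<in>K. x \<noteq> y \<longrightarrow> \<not> c x y) \<or> \<not> mid \<and> ?E"
    proof (cases "\<exists>a\<in>K. \<exists>b\<in>K. isl a \<and> \<not> isl b \<and> c a b")
      case True
      then obtain a b where ab: "a \<in> K" "b \<in> K" "isl a" "\<not> isl b" "c a b" by blast
      define L where "L = K - {a, b}"
      have L: "x \<in> L \<longleftrightarrow> x \<in> K \<and> x \<noteq> a \<and> x \<noteq> b" for x by (auto simp: L_def)
      have same: "x = y" if "x \<in> K" "y \<in> K" "isl x = isl y" "c x y" for x y using D that by blast
      \<comment> \<open>The \<open>B\<close>-feet agree by the second conjunct of \<open>?D\<close>;
        then the \<open>A\<close>-feet lie in one component and agree by the first.\<close>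
      have mixed: "x = a \<and> y = b" if "x \<in> K" "y \<in> K" "isl x" "\<not> isl y" "c x y" for x y
      proof -
        have "y = b" using D that ab by blast
        then show ?thesis using same[OF that(1) ab(1)] that ab c_sym c_trans by metis
      qed
      have "\<not> c x y" if "x \<in> L" "y \<in> L" "x \<noteq> y" for x y
        using that same[of x y] mixed[of x y] mixed[of y x] c_sym[of x y] unfolding L
        by (cases "isl x"; cases "isl y") auto
      then have "\<forall>x\<in>L. \<forall>y\<in>L. x \<noteq> y \<longrightarrow> \<not> c x y" by blast
      moreover have "\<not> c x a" if "x \<in> L" for x
        using that same[of x a] mixed[of a x] c_sym[of x a] ab(1,3) unfolding L by (cases "isl x") auto
      moreover have "K = insert a (insert b L)" using ab by (auto simp: L_def)
      moreover have "\<not> mid" using D ab by blast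
      moreover have "a \<notin> L" "b \<notin> L" using L by auto
      ultimately have ?E using ab(3-5) by (intro exI[of _ a] exI[of _ b] exI[of _ L]) simp
      then show ?thesis using \<open>\<not> mid\<close> by blast
    next
      case False
      then show ?thesis using D c_sym by metis
    qed
  next
    assume "(\<forall>x\<in>K. \<forall>y\<in>K. x \<noteq> y \<longrightarrow> \<not> c x y) \<or> \<not> mid \<and> ?E"
    then show ?D
    proof (elim disjE conjE exE)
      assume none: "\<forall>x\<in>K. \<forall>y\<in>K. x \<noteq> y \<longrightarrow> \<not> c x y"
      then have "\<not> c x y" if "x \<in> K" "y \<in> K" "isl x" "\<not> isl y" for x y using that by auto
      then show ?D using none by blast
    next
      fix a b L
      assume E: "isl a" "\<not> isl b" "c a b" "a \<notin> L" "b \<notin> L" "K = insert a (insert b L)"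
        "\<forall>x\<in>L. \<forall>y\<in>L. x \<noteq> y \<longrightarrow> \<not> c x y" "\<forall>x\<in>L. \<not> c x a" and mid: "\<not> mid"
      have "\<forall>x\<in>L. \<not> c x b" using E(3,8) c_sym c_trans by metis
      then have p: "x = a \<and> y = b \<or> x = b \<and> y = a" if "x \<in> K" "y \<in> K" "x \<noteq> y" "c x y" for x y
        using that E(6-8) c_sym by (metis insert_iff)
      have "x = a \<and> y = b" if "x \<in> K" "y \<in> K" "isl x" "\<not> isl y" "c x y" for x y
        using p[of x y] that E(1,2) by auto
      moreover have "\<not> c x y" if "x \<in> K" "y \<in> K" "isl x = isl y" "x \<noteq> y" for x y
        using p[of x y] that E(1,2) by auto
      ultimately show ?D using mid by blast
    qed
  qed
  then show ?thesis using C D pt[OF subset_refl] by simp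
qed

end

section \<open>Coefficients of the h-polynomial and relabelling of multicomplexes\<close>

lemma h_poly_eq_sum_indep:
  assumes "finite (indep M)"
  shows "h_poly M = (\<Sum>I\<in>indep M. [:-1, 1:] ^ (matroid_rank M - card I))"
proof -
  have le: "card ` indep M \<subseteq> {..matroid_rank M}"
    using assms by (auto simp: matroid_rank_def)
  have "(\<Sum>I\<in>indep M. [:-1, 1 :: int:] ^ (matroid_rank M - card I)) =
      (\<Sum>i\<le>matroid_rank M. \<Sum>I\<in>{I \<in> indep M. card I = i}. [:-1, 1:] ^ (matroid_rank M - card I))"
    by (rule sum.group[OF assms _ le, symmetric]) simp
  also have "\<dots> = (\<Sum>i\<le>matroid_rank M. of_nat (num_indep M i) * [:-1, 1:] ^ (matroid_rank M - i))"
    by (intro sum.cong refl) (simp add: num_indep_def)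
  also have "\<dots> = h_poly M"
    unfolding h_poly_def by (intro sum.cong refl) (simp add: of_nat_poly)
  finally show ?thesis ..
qed

text \<open>The bounds by \<open>d\<close> keep the truncated subtraction injective, so distinct
  values of \<open>f\<close> give distinct powers.\<close>

lemma coeff_sum_X_power:
  assumes "finite S" and "\<And>m. m \<in> S \<Longrightarrow> f m \<le> d" and "k \<le> d"
  shows "coeff (\<Sum>m\<in>S. [:0, 1 :: int:] ^ (d - f m)) (d - k) = int (card {m \<in> S. f m = k})"
proof -
  have X: "[:0, 1 :: int:] ^ n = monom 1 n" for n
    by (simp add: monom_altdef)
  have "coeff (\<Sum>m\<in>S. [:0, 1 :: int:] ^ (d - f m)) (d - k) = (\<Sum>m\<in>S. if f m = k then 1 else 0)"
    unfolding coeff_sum X coeff_monom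
  proof (rule sum.cong[OF refl])
    fix m
    assume "m \<in> S"
    then have "f m \<le> d" by (rule assms(2))
    then have "d - f m = d - k \<longleftrightarrow> f m = k" using assms(3) by arith
    then show "(if d - f m = d - k then 1 else 0 :: int) = (if f m = k then 1 else 0)" by simp
  qed
  also have "\<dots> = int (card {m \<in> S. f m = k})"
    using assms(1) by (simp add: sum.If_cases Int_def)
  finally show ?thesis .
qed

text \<open>An injection of the finite set \<open>X\<close> into the naturals carries the
  multicomplex over. Every facet of the image comes from a facet, so purity is preserved.\<close>

lemma pure_O_sequenceI:
  fixes \<Delta> :: "'x multiset set"
  assumes "multicomplex_on X \<Delta>" and "pure_multicomplex \<Delta>"
    and card: "\<And>i. int (card {m \<in> \<Delta>. size m = i}) = h i"
  shows "pure_O_sequence h"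
proof -
  have X: "finite X" "\<And>m. m \<in> \<Delta> \<Longrightarrow> set_mset m \<subseteq> X"
    "\<And>m m'. m \<in> \<Delta> \<Longrightarrow> m' \<subseteq># m \<Longrightarrow> m' \<in> \<Delta>"
    using assms(1) by (auto simp: multicomplex_on_def)
  obtain f :: "'x \<Rightarrow> nat" where f: "inj_on f X"
    using finite_imp_inj_to_nat_seg[OF X(1)] by blast
  define r where "r = the_inv_into X f"
  have rf: "image_mset r (image_mset f m) = m" if "set_mset m \<subseteq> X" for m
  proof -
    have "image_mset (r \<circ> f) m = image_mset id m"
      using that the_inv_into_f_f[OF f] by (intro image_mset_cong) (auto simp: r_def)
    then show ?thesis by (simp add: multiset.map_comp)
  qed
  have inj: "inj_on (image_mset f) \<Delta>" by (rule inj_onI) (metis rf X(2))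
  have down: "\<exists>m0. m0 \<subseteq># m \<and> m' = image_mset f m0" if m: "m \<in> \<Delta>" "m' \<subseteq># image_mset f m" for m m'
  proof -
    obtain d where d: "image_mset f m = m' + d" using m(2) by (metis subset_mset.add_diff_inverse)
    then obtain a b where "m = a + b" "m' = image_mset f a" "d = image_mset f b"
      by (rule image_mset_eq_plusD[elim_format]) blast
    then show ?thesis by (intro exI[of _ a]) simp
  qed
  let ?D = "image_mset f ` \<Delta>"
  have "multicomplex_on (f ` X) ?D"
    unfolding multicomplex_on_def
  proof (intro conjI ballI allI impI)
    show "finite (f ` X)" using X(1) by simp
  next
    fix m
    assume "m \<in> ?D"
    then show "set_mset m \<subseteq> f ` X" using X(2) by fastforce
  next
    fix m m'
    assume "m \<in> ?D" "m' \<subseteq># m"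
    then obtain m1 m0 where "m1 \<in> \<Delta>" "m0 \<subseteq># m1" "m' = image_mset f m0" using down by blast
    then show "m' \<in> ?D" using X(3) by blast
  qed
  moreover have "pure_multicomplex ?D"
  proof -
    have "\<exists>m0\<in>facets \<Delta>. m = image_mset f m0" if m: "m \<in> facets ?D" for m
    proof -
      obtain m0 where m0: "m0 \<in> \<Delta>" "m = image_mset f m0" using m by (auto simp: facets_def)
      have "m' = m0" if "m' \<in> \<Delta>" "m0 \<subseteq># m'" for m'
      proof -
        have "image_mset f m' = image_mset f m0"
          using m m0 that by (auto simp: facets_def image_mset_subseteq_mono)
        then show ?thesis using inj that(1) m0(1) by (auto dest: inj_onD)
      qed
      then show ?thesis using m0 by (auto simp: facets_def)
    qed
    then show ?thesis using assms(2) unfolding pure_multicomplex_def by (metis size_image_mset)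
  qed
  moreover have "int (card {m \<in> ?D. size m = i}) = h i" for i
  proof -
    have "{m \<in> ?D. size m = i} = image_mset f ` {m \<in> \<Delta>. size m = i}" by auto
    moreover have "inj_on (image_mset f) {m \<in> \<Delta>. size m = i}"
      by (rule inj_on_subset[OF inj]) auto
    ultimately show ?thesis using card[of i] by (simp add: card_image)
  qed
  ultimately show ?thesis unfolding pure_O_sequence_def by blast
qed

section \<open>Counting the independent sets of a biconing\<close>

lemma bicone_edges_mem [simp]:
  "OrigEdge e \<in> bicone_edges F K mid \<longleftrightarrow> e \<in> F"
  "ZeroEdge a \<in> bicone_edges F K mid \<longleftrightarrow> Inl a \<in> K"
  "ZeroBarEdge b \<in> bicone_edges F K mid \<longleftrightarrow> Inr b \<in> K"
  "MidEdge \<in> bicone_edges F K mid \<longleftrightarrow> mid"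
  by (auto simp: bicone_edges_def)

lemma bicone_edges_inject:
  "bicone_edges F K mid = bicone_edges F' K' mid' \<longleftrightarrow> F = F' \<and> K = K' \<and> mid = mid'"
proof
  assume eq: "bicone_edges F K mid = bicone_edges F' K' mid'"
  have "e \<in> F \<longleftrightarrow> e \<in> F'" for e
    using bicone_edges_mem(1)[of e F K mid] bicone_edges_mem(1)[of e F' K' mid'] eq by simp
  moreover have "x \<in> K \<longleftrightarrow> x \<in> K'" for x
    using bicone_edges_mem(2,3)[of _ F K mid] bicone_edges_mem(2,3)[of _ F' K' mid'] eq
    by (cases x) simp_all
  moreover have "mid = mid'"
    using bicone_edges_mem(4)[of F K mid] bicone_edges_mem(4)[of F' K' mid'] eq by simp
  ultimately show "F = F' \<and> K = K' \<and> mid = mid'" by blast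
qed simp

lemma card_bicone_edges:
  fixes F :: "'e set" and K :: "('v + 'v) set"
  assumes "finite F" and "finite K"
  shows "card (bicone_edges F K mid) = card F + card K + (if mid then 1 else 0)"
proof -
  define enc :: "('e + ('v + 'v)) + unit \<Rightarrow> ('v, 'e) bicone_edge" where
    "enc = case_sum (case_sum OrigEdge (case_sum ZeroEdge ZeroBarEdge)) (\<lambda>_. MidEdge)"
  have "inj enc" by (auto simp: inj_def enc_def split: sum.splits)
  moreover have "bicone_edges F K mid = enc ` ((F <+> K) <+> (if mid then {()} else {}))"
  proof (intro equalityI subsetI)
    fix x
    assume "x \<in> bicone_edges F K mid"
    then show "x \<in> enc ` ((F <+> K) <+> (if mid then {()} else {}))"
    proof (cases x)
      case (OrigEdge e)
      then show ?thesis using \<open>x \<in> _\<close> by (intro image_eqI[of _ _ "Inl (Inl e)"]) (auto simp: enc_def)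
    next
      case MidEdge
      then show ?thesis using \<open>x \<in> _\<close> by (intro image_eqI[of _ _ "Inr ()"]) (auto simp: enc_def)
    next
      case (ZeroEdge a)
      then show ?thesis using \<open>x \<in> _\<close> by (intro image_eqI[of _ _ "Inl (Inr (Inl a))"]) (auto simp: enc_def)
    next
      case (ZeroBarEdge b)
      then show ?thesis using \<open>x \<in> _\<close> by (intro image_eqI[of _ _ "Inl (Inr (Inr b))"]) (auto simp: enc_def)
    qed
  next
    fix x
    assume "x \<in> enc ` ((F <+> K) <+> (if mid then {()} else {}))"
    then show "x \<in> bicone_edges F K mid"
      by (auto simp: enc_def split: sum.splits if_splits)
  qed
  ultimately show ?thesis
    using assms by (simp add: card_image inj_on_subset[OF _ subset_UNIV] card_Plus)
qed

context biconed_graph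
begin

text \<open>The Boolean tells whether \<open>MidEdge\<close> is present; two feet in one component
  exclude it.\<close>

abbreviation cone_configs :: "('e + 'v) set \<Rightarrow> (('v + 'v) set \<times> bool) set" where
  "cone_configs F \<equiv> ptrans (vcomp F) (A <+> B) \<times> UNIV \<union>
    {K. K \<subseteq> A <+> B \<and> mset_set K \<in> cone_doubles F} \<times> {False}"

lemma in_indep_iff:
  assumes "F \<subseteq> edges G" and "K \<subseteq> A <+> B"
  shows "bicone_edges F K mid \<in> indep (graphic_matroid (biconing G A B)) \<longleftrightarrow>
    forest (ends G) F \<and> (K, mid) \<in> cone_configs (split_edges F)"
proof -
  have "bicone_edges F K mid \<subseteq> edges (biconing G A B)"
    using assms by (auto simp: bicone_edges_def biconing_def)
  moreover have "finite K" using assms(2) finV by (rule finite_subset)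
  ultimately show ?thesis
    unfolding indep_def graphic_matroid_def
    using acyclic_edges_iff_forest[OF finite_graph_biconing[OF finG AB], of "bicone_edges F K mid"]
      forest_bicone_edges[of K "ends G" F mid] cone_condition_iff[OF assms, of mid] assms(2)
    by (simp add: biconing_def) blast
qed

lemma indep_eq:
  "indep (graphic_matroid (biconing G A B)) =
    (\<lambda>(F, K, mid). bicone_edges F K mid) `
      (SIGMA F:{F. F \<subseteq> edges G \<and> forest (ends G) F}. cone_configs (split_edges F))"
proof (intro equalityI subsetI)
  fix I
  assume I: "I \<in> indep (graphic_matroid (biconing G A B))"
  define F where "F = OrigEdge -` I"
  define K where "K = ZeroEdge -` I <+> ZeroBarEdge -` I"
  have IE: "I \<subseteq> edges (biconing G A B)"
    using I by (simp add: indep_def graphic_matroid_def acyclic_edges_def)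
  then have sub: "F \<subseteq> edges G" "K \<subseteq> A <+> B" by (auto simp: F_def K_def biconing_def)
  have "x \<in> I \<longleftrightarrow> x \<in> bicone_edges F K (MidEdge \<in> I)" for x
    by (cases x) (auto simp: F_def K_def)
  then have eq: "I = bicone_edges F K (MidEdge \<in> I)" by blast
  then have "forest (ends G) F" "(K, MidEdge \<in> I) \<in> cone_configs (split_edges F)"
    using in_indep_iff[OF sub, of "MidEdge \<in> I"] I by simp_all
  then show "I \<in> (\<lambda>(F, K, mid). bicone_edges F K mid) `
      (SIGMA F:{F. F \<subseteq> edges G \<and> forest (ends G) F}. cone_configs (split_edges F))"
    using eq sub(1) by (intro image_eqI[of _ _ "(F, K, MidEdge \<in> I)"]) auto
next
  fix I
  assume "I \<in> (\<lambda>(F, K, mid). bicone_edges F K mid) `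
      (SIGMA F:{F. F \<subseteq> edges G \<and> forest (ends G) F}. cone_configs (split_edges F))"
  then obtain p where p: "I = (\<lambda>(F, K, mid). bicone_edges F K mid) p"
    "p \<in> (SIGMA F:{F. F \<subseteq> edges G \<and> forest (ends G) F}. cone_configs (split_edges F))"
    by (rule imageE)
  obtain F K mid where "p = (F, K, mid)" by (cases p)
  then have I: "I = bicone_edges F K mid" "F \<subseteq> edges G" "forest (ends G) F"
    "(K, mid) \<in> cone_configs (split_edges F)"
    using p by simp_all
  then have "K \<subseteq> A <+> B" by (auto simp: ptrans_def)
  then show "I \<in> indep (graphic_matroid (biconing G A B))" using in_indep_iff I by simp
qed

text \<open>Splitting adds \<open>card (A \<inter> B)\<close> vertices and as many edges to every
  forest, so the surplus cancels.\<close>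

lemma card_split:
  assumes "F \<subseteq> edges G" and "forest (ends G) F"
  shows "card F + card (components split_ends (A <+> B) (split_edges F)) = card (verts G)"
proof -
  have fin: "finite F" using assms(1) finite_AB(3) by (rule finite_subset)
  have "split_edges F \<in> forests" using forests_eq assms by blast
  then have "card F + card (A \<inter> B) + card (components split_ends (A <+> B) (split_edges F)) = card A + card B"
    using card_forest_components[of "split_edges F"] fin finite_AB
    by (simp add: split_edges_def card_Plus)
  then show ?thesis
    using card_Un_Int[OF finite_AB(1,2)] AB by simp
qed

text \<open>The free choice of \<open>MidEdge\<close> turns every transversal into two terms whose
  exponents differ by one, hence the factor \<open>u + 1\<close>. Double markings exclude
  \<open>MidEdge\<close> and get no such factor.\<close>

lemma sum_cone_configs:
  fixes u :: "'a::comm_semiring_1"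
  assumes F: "F \<in> forests"
  defines "\<C> \<equiv> components split_ends (A <+> B) F"
  shows "(\<Sum>(K, mid)\<in>cone_configs F. u ^ (Suc (card \<C>) - (card K + (if mid then 1 else 0)))) =
    (u + 1) * (\<Prod>C\<in>\<C>. u + of_nat (card C)) +
    (\<Sum>z\<in>mixed_pairs F. \<Prod>C\<in>\<C> - {pair_component F z}. u + of_nat (card C))"
proof -
  interpret marked_pairs \<C> "A <+> B" "vcomp F" "mixed_pairs F" "pair_component F" side_pair
    unfolding \<C>_def by (rule marked_pairs_cone[OF F])
  let ?P = "ptrans (vcomp F) (A <+> B)"
  let ?D = "{K. K \<subseteq> A <+> B \<and> mset_set K \<in> cone_doubles F}"
  let ?f = "\<lambda>(K, mid). u ^ (Suc (card \<C>) - (card K + (if mid then 1 else 0)))"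
  have finK: "K \<subseteq> A <+> B \<Longrightarrow> finite K" for K using finV finite_subset by blast
  have "?P \<inter> ?D = {}" using single_double_disjoint by (auto simp: single_marks_def)
  then have disj: "(?P \<times> UNIV) \<inter> (?D \<times> {False}) = {}" by blast
  have finP: "finite (?P \<times> (UNIV :: bool set))"
    by (intro finite_cartesian_product finite_ptrans finV finite)
  have finD: "finite (?D \<times> {False})"
    by (rule finite_subset[of _ "Pow (A <+> B) \<times> {False}"]) (use finV in auto)
  have fib: "{x \<in> A <+> B. vcomp F x = C} = C" if "C \<in> \<C>" for C
    using component_fibre that unfolding \<C>_def by blast
  have "sum ?f (?P \<times> UNIV) = (\<Sum>K\<in>?P. u ^ (Suc (card \<C>) - card K) + u ^ (card \<C> - card K))"
    unfolding sum.cartesian_product[symmetric] by (simp add: UNIV_bool add.commute)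
  also have "\<dots> = (\<Sum>K\<in>?P. (u + 1) * u ^ (card \<C> - card K))"
    using card_ptrans_le[OF fin(1) cls(1)]
    by (intro sum.cong refl) (simp add: Suc_diff_le distrib_right)
  also have "\<dots> = (u + 1) * (\<Prod>C\<in>\<C>. u + of_nat (card C))"
    using sum_ptrans[OF fin(1) finV cls(1), of u] fib
    by (simp add: sum_distrib_left[symmetric])
  finally have 1: "sum ?f (?P \<times> UNIV) = (u + 1) * (\<Prod>C\<in>\<C>. u + of_nat (card C))" .
  \<comment> \<open>The two feet of the pair are distinct and lie in a class that the rest of the
    marking avoids, so double markings are multiplicity-free and come from sets of feet.\<close>
  have eq: "cone_doubles F = mset_set ` ?D"
  proof (intro equalityI subsetI)
    fix W
    assume W: "W \<in> cone_doubles F"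
    then obtain a b L where L: "(a, b) \<in> mixed_pairs F"
      "L \<in> ptrans (vcomp F) {x \<in> A <+> B. vcomp F x \<noteq> pair_component F (a, b)}"
      "W = side_pair (a, b) + mset_set L"
      by (auto simp: double_marks_def)
    have LV: "L \<subseteq> A <+> B" using L(2) by (auto simp: ptrans_def)
    have ab: "a \<noteq> b" "a \<in> A <+> B" "b \<in> A <+> B" using L(1) by (auto simp: mixed_pairs_def)
    have "vcomp F a = pair_component F (a, b)" "vcomp F b = pair_component F (a, b)"
      using pr(2)[OF L(1)] by (auto simp: side_pair_def)
    then have "a \<notin> L" "b \<notin> L" using L(2) by (auto simp: ptrans_def)
    then have "W = mset_set (insert a (insert b L))"
      using L(3) ab(1) finK[OF LV] by (simp add: side_pair_def)
    then show "W \<in> mset_set ` ?D" using W LV ab by blast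
  qed auto
  have inj: "inj_on mset_set ?D"
    using finK by (intro inj_onI) (metis (mono_tags, lifting) finite_set_mset_mset_set mem_Collect_eq)
  have "(\<Sum>W\<in>cone_doubles F. u ^ (Suc (card \<C>) - size W)) = (\<Sum>K\<in>?D. u ^ (Suc (card \<C>) - card K))"
    by (subst eq) (simp add: sum.reindex[OF inj])
  also have "\<dots> = sum ?f (?D \<times> {False})"
    unfolding sum.cartesian_product[symmetric] by simp
  finally have "sum ?f (?D \<times> {False}) = (\<Sum>z\<in>mixed_pairs F. \<Prod>C\<in>\<C> - {pair_component F z}. u + of_nat (card C))"
    using sum_double_marks[of u] fib by simp
  then show ?thesis using 1 by (simp add: sum.union_disjoint[OF finP finD disj])
qed

lemma card_split_diff: "card (A <+> B) - card (Inr ` (A \<inter> B) :: ('e + 'v) set) + 1 = Suc (card (verts G))"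
  using card_Un_Int[OF finite_AB(1,2)] AB finite_AB by (simp add: card_Plus card_image)

text \<open>The comparison of the two counts. Both are sums over the same forests with products over
  the same components, and the factors agree after the shift from \<open>u\<close> to
  \<open>u + 1\<close>.\<close>

lemma sum_indep:
  fixes u :: "'a::comm_semiring_1"
  shows "(\<Sum>I\<in>indep (graphic_matroid (biconing G A B)). u ^ (Suc (card (verts G)) - card I)) =
    (\<Sum>m\<in>monomials. (u + 1) ^ (Suc (card (verts G)) - size m))"
proof -
  let ?FG = "{F. F \<subseteq> edges G \<and> forest (ends G) F}"
  let ?C = "\<lambda>F. components split_ends (A <+> B) F"
  have finK: "K \<subseteq> A <+> B \<Longrightarrow> finite K" for K using finV finite_subset by blast
  have "inj_on (\<lambda>(F, K, mid). bicone_edges F K mid) (SIGMA F:?FG. cone_configs (split_edges F))"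
    by (rule inj_onI) (auto simp: bicone_edges_inject)
  then have "(\<Sum>I\<in>indep (graphic_matroid (biconing G A B)). u ^ (Suc (card (verts G)) - card I)) =
    (\<Sum>(F, K, mid)\<in>(SIGMA F:?FG. cone_configs (split_edges F)).
      u ^ (Suc (card (verts G)) - card (bicone_edges F K mid)))"
    unfolding indep_eq by (simp add: sum.reindex case_prod_unfold)
  also have "\<dots> = (\<Sum>F\<in>?FG. \<Sum>(K, mid)\<in>cone_configs (split_edges F).
      u ^ (Suc (card (verts G)) - card (bicone_edges F K mid)))"
  proof (subst sum.Sigma)
    show "finite ?FG" using finite_AB(3) by simp
    show "\<forall>F\<in>?FG. finite (cone_configs (split_edges F))"
      by (intro ballI finite_subset[of "cone_configs _" "Pow (A <+> B) \<times> UNIV"])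
        (use finV in \<open>auto simp: ptrans_def\<close>)
  qed (simp add: case_prod_unfold)
  also have "\<dots> = (\<Sum>F\<in>?FG. \<Sum>(K, mid)\<in>cone_configs (split_edges F).
      u ^ (Suc (card (?C (split_edges F))) - (card K + (if mid then 1 else 0))))"
  proof (intro sum.cong refl, clarify)
    fix F K mid
    assume F: "F \<subseteq> edges G" "forest (ends G) F" and K: "(K, mid) \<in> cone_configs (split_edges F)"
    have "finite F" using F(1) finite_AB(3) by (rule finite_subset)
    moreover have "finite K" using K finK by (auto simp: ptrans_def)
    ultimately show "u ^ (Suc (card (verts G)) - card (bicone_edges F K mid)) =
      u ^ (Suc (card (?C (split_edges F))) - (card K + (if mid then 1 else 0)))"
      using card_split[OF F] card_bicone_edges[of F K mid]
      by (intro arg_cong[where f = "\<lambda>n. u ^ n"]) simp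
  qed
  also have "\<dots> = (\<Sum>F\<in>forests. \<Sum>(K, mid)\<in>cone_configs F.
      u ^ (Suc (card (?C F)) - (card K + (if mid then 1 else 0))))"
    unfolding forests_eq by (simp add: sum.reindex inj_on_subset[OF inj_split_edges])
  also have "\<dots> = (\<Sum>F\<in>forests. (u + 1) * (\<Prod>C\<in>?C F. u + of_nat (card C)) +
    (\<Sum>z\<in>mixed_pairs F. \<Prod>C\<in>?C F - {pair_component F z}. u + of_nat (card C)))"
    by (rule sum.cong[OF refl]) (rule sum_cone_configs)
  also have "\<dots> = (\<Sum>F\<in>forests.
      (u + 1) * (\<Prod>C\<in>?C F. u + 1 + of_nat (card {e \<in> F. ecomp F e = C})) +
      (\<Sum>z\<in>mixed_pairs F. \<Prod>C\<in>?C F - {pair_component F z}.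
        u + 1 + of_nat (card {e \<in> F. ecomp F e = C})))"
  proof (rule sum.cong[OF refl])
    fix F
    assume F: "F \<in> forests"
    \<comment> \<open>A component is a tree, so its vertices number one more than its edges; the
      surplus vertex turns \<open>u\<close> into \<open>u + 1\<close>.\<close>
    have "u + of_nat (card C) = u + 1 + of_nat (card {e \<in> F. ecomp F e = C})" if "C \<in> ?C F" for C
      using card_edges_in_component[of F "A <+> B" split_ends C] forestsD[OF F] finV that
      by (simp add: add.assoc)
    then show "(u + 1) * (\<Prod>C\<in>?C F. u + of_nat (card C)) +
      (\<Sum>z\<in>mixed_pairs F. \<Prod>C\<in>?C F - {pair_component F z}. u + of_nat (card C)) =
      (u + 1) * (\<Prod>C\<in>?C F. u + 1 + of_nat (card {e \<in> F. ecomp F e = C})) +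
      (\<Sum>z\<in>mixed_pairs F. \<Prod>C\<in>?C F - {pair_component F z}.
        u + 1 + of_nat (card {e \<in> F. ecomp F e = C}))"
      by simp
  qed
  also have "\<dots> = (\<Sum>m\<in>monomials. (u + 1) ^ (card (A <+> B) - card (Inr ` (A \<inter> B) :: ('e + 'v) set) + 1 - size m))"
    by (rule sum_monomials[symmetric])
  finally show ?thesis unfolding card_split_diff .
qed

lemma card_indep_le:
  assumes "I \<in> indep (graphic_matroid (biconing G A B))"
  shows "card I \<le> Suc (card (verts G))"
proof -
  obtain p where p: "I = (\<lambda>(F, K, mid). bicone_edges F K mid) p"
    "p \<in> (SIGMA F:{F. F \<subseteq> edges G \<and> forest (ends G) F}. cone_configs (split_edges F))"
    using assms unfolding indep_eq by (rule imageE)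
  obtain F K mid where "p = (F, K, mid)" by (cases p)
  then have I: "I = bicone_edges F K mid" and F: "F \<subseteq> edges G" "forest (ends G) F"
    and K: "(K, mid) \<in> cone_configs (split_edges F)"
    using p by simp_all
  let ?C = "components split_ends (A <+> B) (split_edges F)"
  have F': "split_edges F \<in> forests" using F forests_eq by blast
  interpret marked_pairs ?C "A <+> B" "vcomp (split_edges F)" "mixed_pairs (split_edges F)"
    "pair_component (split_edges F)" side_pair
    by (rule marked_pairs_cone[OF F'])
  have "card K + (if mid then 1 else 0) \<le> Suc (card ?C)"
  proof (cases "K \<in> ptrans (vcomp (split_edges F)) (A <+> B)")
    case True
    then show ?thesis using card_ptrans_le[OF fin(1) cls(1) True] by simp
  next
    case False
    then have "\<not> mid" "mset_set K \<in> cone_doubles (split_edges F)" using K by auto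
    then obtain z L where "z \<in> mixed_pairs (split_edges F)"
      "L \<in> ptrans (vcomp (split_edges F)) {x \<in> A <+> B. vcomp (split_edges F) x \<noteq> pair_component (split_edges F) z}"
      "mset_set K = side_pair z + mset_set L"
      by (auto simp: double_marks_def)
    then have "size (mset_set K) \<le> Suc (card ?C)" using card_double_le pr(1) by fastforce
    then show ?thesis using \<open>\<not> mid\<close> by simp
  qed
  moreover have "finite F" using F(1) finite_AB(3) by (rule finite_subset)
  moreover have "finite K" using K finV finite_subset[of K "A <+> B"] by (auto simp: ptrans_def)
  ultimately show ?thesis using card_split[OF F] card_bicone_edges[of F K mid] I by simp
qed

lemma finite_indep: "finite (indep (graphic_matroid (biconing G A B)))"
proof (rule finite_subset)
  show "finite (Pow (edges (biconing G A B)))"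
    using finite_graph_biconing[OF finG AB] by (simp add: finite_graph_def)
qed (auto simp: indep_def graphic_matroid_def acyclic_edges_def)

text \<open>\<open>card_indep_le\<close> gives the upper bound. It is attained by a spanning tree
  that consists of \<open>MidEdge\<close> and one cone edge at each vertex of \<open>G\<close>,
  chosen by \<open>lift\<close>.\<close>

lemma rank_biconing: "matroid_rank (graphic_matroid (biconing G A B)) = Suc (card (verts G))"
proof -
  have K: "lift ` verts G \<subseteq> A <+> B" using lift_in by blast
  have empty: "conn (ends G) {} x y \<longleftrightarrow> x = y" for x y by (simp add: conn_def adj_def)
  have "inj_on (vcomp (split_edges {})) (lift ` verts G)"
  proof (rule inj_onI, clarify)
    fix v w
    assume vw: "v \<in> verts G" "w \<in> verts G"
      and "vcomp (split_edges {}) (lift v) = vcomp (split_edges {}) (lift w)"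
    then have "conn split_ends (split_edges {}) (lift v) (lift w)"
      using component_eq_iff[of "lift w" "A <+> B" split_ends "split_edges {}" "lift v"] lift_in by simp
    then show "lift v = lift w" using conn_split_imp empty by fastforce
  qed
  then have "(lift ` verts G, True) \<in> cone_configs (split_edges {})" using K by (simp add: ptrans_def)
  moreover have "forest (ends G) {}" by (simp add: forest_def)
  ultimately have "bicone_edges {} (lift ` verts G) True \<in> indep (graphic_matroid (biconing G A B))"
    using in_indep_iff[of "{}" "lift ` verts G" True] K by simp
  moreover have "inj lift" by (rule inj_on_inverseI[of _ drop_side]) simp
  then have "card (bicone_edges {} (lift ` verts G) True) = Suc (card (verts G))"
    using card_bicone_edges[of "{}" "lift ` verts G" True] finG
    by (simp add: finite_graph_def card_image inj_on_subset[OF _ subset_UNIV])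
  ultimately have "Suc (card (verts G)) \<in> card ` indep (graphic_matroid (biconing G A B))"
    by (metis imageI)
  then show ?thesis
    unfolding matroid_rank_def using card_indep_le finite_indep by (intro Max_eqI) auto
qed

text \<open>The h-polynomial becomes a sum of powers of the variable, one per monomial, and its
  coefficients count monomials by degree. Above the rank both sides vanish, as no monomial is that
  large.\<close>

lemma card_monomials:
  "int (card {m \<in> monomials. size m = k}) = h_vector (graphic_matroid (biconing G A B)) k"
proof -
  let ?d = "Suc (card (verts G))"
  have size: "size m \<le> ?d" if "m \<in> monomials" for m
    using that size_monomial(2) unfolding card_split_diff by (auto simp: monomials_def)
  have "finite (SIGMA F:forests. singles F \<union> doubles F)"
    using finite_forests finite_singles finite_doubles by (intro finite_SigmaI) auto
  then have "finite ((\<lambda>(F, W). mset_set (F - Inr ` (A \<inter> B)) + W) ` (SIGMA F:forests. singles F \<union> doubles F))"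
    by (rule finite_imageI)
  moreover have "monomials = (\<lambda>(F, W). mset_set (F - Inr ` (A \<inter> B)) + W) ` (SIGMA F:forests. singles F \<union> doubles F)"
    by (auto simp: monomials_def)
  ultimately have fin: "finite monomials" by simp
  \<comment> \<open>Taking the polynomial \<open>[:-1, 1:]\<close> for \<open>u\<close> in
    \<open>sum_indep\<close> makes \<open>u + 1\<close> the variable itself.\<close>
  have "[:-1, 1 :: int:] + 1 = [:0, 1:]" by (simp add: one_pCons)
  then have h: "h_poly (graphic_matroid (biconing G A B)) = (\<Sum>m\<in>monomials. [:0, 1:] ^ (?d - size m))"
    using sum_indep[of "[:-1, 1 :: int:]"] h_poly_eq_sum_indep[OF finite_indep] by (simp add: rank_biconing)
  show ?thesis
  proof (cases "k \<le> ?d")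
    case True
    then show ?thesis
      using coeff_sum_X_power[OF fin size True] by (simp add: h_vector_def rank_biconing h)
  next
    case False
    then have "{m \<in> monomials. size m = k} = {}" using size by auto
    then show ?thesis using False by (simp only: h_vector_def rank_biconing) simp
  qed
qed

end

theorem theorem1p4:
  fixes G :: "('v, 'e) multigraph" and A B :: "'v set"
  assumes "finite_graph G"
    and "A \<subseteq> verts G" and "B \<subseteq> verts G" and "A \<union> B = verts G"
  shows "pure_O_sequence (h_vector (graphic_matroid (biconing G A B)))"
proof -
  interpret biconed_graph G A B
    by (rule biconed_graph.intro) (rule assms)+
  show ?thesis
    by (rule pure_O_sequenceI[OF multicomplex_monomials pure_monomials card_monomials])
qed

end
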